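(* Suppose $f_1(x,y)$ and $f_2(x,y)$ are two relatively prime real cubic polynomials with exactly nine distinct real common zeros in $\mathbb R^2$. Then Hilbert's Method (with $d=3$) applies to any subset $A$ consisting of eight of the common zeros.
   Context: A real polynomial $p(x,y)$ is positive (psd) if $p(a)\ge0$ for all $a\in\mathbb R^2$, and sos if it is a finite sum of squares of real polynomials. For a finite set $A\subset\mathbb R^2$: $I_{1,3}(A)$ is the vector space of real polynomials in $x,y$ of degree $\le 3$ vanishing on $A$; $I_{2,6}(A)$ is the vector space of real polynomials of degree $\le 6$ that vanish together with both first partial derivatives at every point of $A$; $I_{1,3}^2(A)$ is the set of finite sums $\sum_i h_ik_i$ with $h_i,k_i\in I_{1,3}(A)$. $\tilde A$ is the set of common real zeros in $\mathbb R^2$ of all elements of $I_{1,3}(A)$ that are not in $A$. $A$ is full if for every $\pi\in A$ and $v\in\mathbb R^2$ there is $h\in I_{1,3}(A)$ with $\vec\nabla h(\pi)=v$. A polynomial $f$ of degree $m$ has a zero at infinity if its homogenization $z^mf(x/z,y/z)$ vanishes at some $(a,b,0)\ne(0,0,0)$ with $a,b$ real. "Hilbert's Method applies to $A$" (with $d=3$) means: for a basis $\{h_1,\dots,h_s\}$ of $I_{1,3}(A)$, the set $\tilde A$ is finite, $A$ is full, $\sum_j h_j^2$ has no zeros at infinity, and there exists $g\in I_{2,6}(A)\smallsetminus I_{1,3}^2(A)$ with $g(w)>0$ for every $w\in\tilde A$; and thus there is $c>0$ such that $\sum_j h_j^2+cg$ is positive and not sos. *)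

theory Defs
  imports "HOL-Computational_Algebra.Computational_Algebra"
begin

text \<open>
  A real polynomial in \<open>x\<close>, \<open>y\<close> is an element of \<^typ>\<open>real poly poly\<close>: the outer variable is
  \<open>y\<close> and the coefficients are polynomials in \<open>x\<close>, so \<open>coeff (coeff f j) i\<close> is the coefficient
  of \<open>x\<^sup>i y\<^sup>j\<close>. Note that \<^const>\<open>degree\<close> is then the degree in \<open>y\<close> only.
\<close>

type_synonym poly2 = "real poly poly"

definition eval2 :: "poly2 \<Rightarrow> real \<times> real \<Rightarrow> real" where
  "eval2 f a = poly (poly f [:snd a:]) (fst a)"

definition partial_x :: "poly2 \<Rightarrow> poly2" where
  "partial_x f = map_poly pderiv f"

definition partial_y :: "poly2 \<Rightarrow> poly2" where
  "partial_y f = pderiv f"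

definition gradient :: "poly2 \<Rightarrow> real \<times> real \<Rightarrow> real \<times> real" where
  "gradient f a = (eval2 (partial_x f) a, eval2 (partial_y f) a)"

text \<open>The zero polynomial gets total degree 0.\<close>

definition total_degree :: "poly2 \<Rightarrow> nat" where
  "total_degree f = Max (insert 0 {i + j | i j. coeff (coeff f j) i \<noteq> 0})"

definition psd :: "poly2 \<Rightarrow> bool" where
  "psd f \<longleftrightarrow> (\<forall>a. eval2 f a \<ge> 0)"

definition sos :: "poly2 \<Rightarrow> bool" where
  "sos f \<longleftrightarrow> (\<exists>(n::nat) q. f = (\<Sum>i<n. (q i)\<^sup>2))"

text \<open>
  \<open>homogenization f x y z = z\<^sup>m f(x/z, y/z)\<close> with \<open>m\<close> the total degree of \<open>f\<close>, written out
  so that it also makes sense for \<open>z = 0\<close>.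
\<close>

definition homogenization :: "poly2 \<Rightarrow> real \<Rightarrow> real \<Rightarrow> real \<Rightarrow> real" where
  "homogenization f x y z =
     (let m = total_degree f in
      \<Sum>i\<le>m. \<Sum>j\<le>m - i. coeff (coeff f j) i * x ^ i * y ^ j * z ^ (m - i - j))"

definition zero_at_infinity :: "poly2 \<Rightarrow> bool" where
  "zero_at_infinity f \<longleftrightarrow> (\<exists>a b. (a, b, 0::real) \<noteq> (0, 0, 0) \<and> homogenization f a b 0 = 0)"

definition I1 :: "nat \<Rightarrow> (real \<times> real) set \<Rightarrow> poly2 set" where
  "I1 d A = {h. total_degree h \<le> d \<and> (\<forall>a\<in>A. eval2 h a = 0)}"

definition I2 :: "nat \<Rightarrow> (real \<times> real) set \<Rightarrow> poly2 set" where
  "I2 d A = {g. total_degree g \<le> d \<and>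
                (\<forall>a\<in>A. eval2 g a = 0 \<and> eval2 (partial_x g) a = 0 \<and> eval2 (partial_y g) a = 0)}"

definition I1_squared :: "nat \<Rightarrow> (real \<times> real) set \<Rightarrow> poly2 set" where
  "I1_squared d A =
     {f. \<exists>(n::nat) h k. (\<forall>i<n. h i \<in> I1 d A \<and> k i \<in> I1 d A) \<and> f = (\<Sum>i<n. h i * k i)}"

definition tilde :: "nat \<Rightarrow> (real \<times> real) set \<Rightarrow> (real \<times> real) set" where
  "tilde d A = {w. \<forall>h\<in>I1 d A. eval2 h w = 0} - A"

definition full :: "nat \<Rightarrow> (real \<times> real) set \<Rightarrow> bool" where
  "full d A \<longleftrightarrow> (\<forall>\<pi>\<in>A. \<forall>v. \<exists>h\<in>I1 d A. gradient h \<pi> = v)"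

interpretation poly2: vector_space "\<lambda>(c::real) (f::poly2). smult [:c:] f"
proof
  show "smult [:a + b:] f = smult [:a:] f + smult [:b:] f" for a b :: real and f :: poly2
    using smult_add_left[of "[:a:]" "[:b:]" f] by simp
qed (simp_all add: smult_add_right mult.commute flip: one_pCons)

definition is_basis :: "poly2 set \<Rightarrow> poly2 set \<Rightarrow> bool" where
  "is_basis H V \<longleftrightarrow> finite H \<and> H \<subseteq> V \<and> poly2.independent H \<and> V \<subseteq> poly2.span H"

text \<open>
  The conditions are required for every basis of \<open>I1 d A\<close>; a basis exists by
  \<open>ex_basis_I1\<close> below, so this is not vacuous.
\<close>

definition hilberts_method_applies :: "nat \<Rightarrow> (real \<times> real) set \<Rightarrow> bool" where
  "hilberts_method_applies d A \<longleftrightarrow>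
     (\<forall>H. is_basis H (I1 d A) \<longrightarrow>
        finite (tilde d A) \<and>
        full d A \<and>
        \<not> zero_at_infinity (\<Sum>h\<in>H. h\<^sup>2) \<and>
        (\<exists>g \<in> I2 (2 * d) A - I1_squared d A.
           (\<forall>w\<in>tilde d A. eval2 g w > 0) \<and>
           (\<exists>c::real. c > 0 \<and>
              psd ((\<Sum>h\<in>H. h\<^sup>2) + smult [:c:] g) \<and>
              \<not> sos ((\<Sum>h\<in>H. h\<^sup>2) + smult [:c:] g))))"

lemma finite_support: "finite {i + j | i j. coeff (coeff (f::poly2) j) i \<noteq> 0}"
proof (rule finite_subset)
  let ?J = "{..degree f}"
  show "{i + j | i j. coeff (coeff f j) i \<noteq> 0} \<subseteq>
        (\<lambda>(j, i). i + j) ` (SIGMA j:?J. {..degree (coeff f j)})"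
  proof
    fix m assume "m \<in> {i + j | i j. coeff (coeff f j) i \<noteq> 0}"
    then obtain i j where m: "m = i + j" and c: "coeff (coeff f j) i \<noteq> 0" by blast
    from c have "coeff f j \<noteq> 0" by auto
    hence "j \<le> degree f" by (rule le_degree)
    moreover from c have "i \<le> degree (coeff f j)" by (rule le_degree)
    ultimately show "m \<in> (\<lambda>(j, i). i + j) ` (SIGMA j:?J. {..degree (coeff f j)})"
      using m by force
  qed
qed auto

lemma total_degree_le_iff:
  "total_degree f \<le> d \<longleftrightarrow> (\<forall>i j. d < i + j \<longrightarrow> coeff (coeff f j) i = 0)"
  unfolding total_degree_def
  by (subst Max_le_iff) (use finite_support[of f] in \<open>auto simp: not_le[symmetric]\<close>)

lemma ex_basis_I1: "\<exists>H. is_basis H (I1 d A)"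
proof -
  let ?M = "(\<lambda>(i, j). monom (monom (1::real) i) j) ` ({..d} \<times> {..d})"
  have sub: "I1 d A \<subseteq> poly2.span ?M"
  proof
    fix h assume "h \<in> I1 d A"
    hence z: "coeff (coeff h j) i = 0" if "d < i + j" for i j
      using that by (auto simp: I1_def total_degree_le_iff)
    have "h = (\<Sum>j\<le>d. \<Sum>i\<le>d. smult [:coeff (coeff h j) i:] (monom (monom 1 i) j))"
    proof (intro poly_eqI)
      fix n m
      have e: "coeff (coeff (smult [:c:] (monom (monom 1 i) j)) n) m =
               (if i = m then if j = n then c else 0 else 0)" for c :: real and i j
        by auto
      show "coeff (coeff h n) m = coeff (coeff (\<Sum>j\<le>d. \<Sum>i\<le>d.
                smult [:coeff (coeff h j) i:] (monom (monom 1 i) j)) n) m"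
        unfolding coeff_sum e sum.delta[OF finite_atMost]
        using z[of m n] by (cases "m \<le> d"; cases "n \<le> d") simp_all
    qed
    also have "\<dots> \<in> poly2.span ?M"
      by (intro poly2.span_sum poly2.span_scale poly2.span_base) auto
    finally show "h \<in> poly2.span ?M" .
  qed
  obtain H where H: "H \<subseteq> I1 d A" "poly2.independent H" "I1 d A \<subseteq> poly2.span H"
    using poly2.maximal_independent_subset by blast
  have "finite H"
    using poly2.independent_span_bound[of ?M H] H sub by auto
  with H show ?thesis by (auto simp: is_basis_def)
qed

end

theory Submission
  imports Defs "HOL-Computational_Algebra.Field_as_Ring" "HOL-Analysis.Analysis"
begin

text \<open>
  Let \<open>Z\<close> be the set of the nine common zeros. No four of them are collinear, so for each point of
  \<open>Z\<close> there is a product of four lines through the other eight that avoids it. Counting dimensions,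
  every polynomial of degree \<open>d \<in> {4, 5, 6}\<close> vanishing on \<open>Z\<close> is therefore \<open>a f1 + b f2\<close> with
  \<open>a\<close> and \<open>b\<close> of degree at most \<open>d - 3\<close>. Applied to products of five lines covering \<open>Z\<close>, this
  shows that \<open>f1\<close> and \<open>f2\<close> meet transversally and have no common zero at infinity. Applied to a
  cubic through eight of the points times a linear form vanishing at the ninth point \<open>w\<close>, it shows
  that the cubic lies in the span of \<open>f1\<close> and \<open>f2\<close>.

  A sextic \<open>a f1 + b f2\<close> that is singular at the eight points of \<open>A\<close> has \<open>a\<close> and \<open>b\<close> vanishing on
  \<open>A\<close>, so it is a quadratic form in \<open>f1\<close> and \<open>f2\<close>. Sextics singular on \<open>A\<close> form a space of
  dimension at least 4, hence some such \<open>g\<close> has \<open>g(w) > 0\<close>. A small multiple of \<open>g\<close> can be added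
  to the sum of squares by compactness, and the result is not sos because the summands would be
  cubics through \<open>A\<close>, which vanish at \<open>w\<close>.
\<close>

subsection \<open>Linear systems and pairings\<close>

text \<open>Gaussian elimination, by induction on the equations. If equation \<open>k\<close>
  involves some unknown \<open>j\<close>, it is solved for that unknown and the result is
  substituted into the others, which costs one equation and one unknown.\<close>

lemma underdetermined_system:
  fixes A :: "'i \<Rightarrow> 'k \<Rightarrow> real"
  assumes "finite K" "finite I" "card K < card I"
  shows "\<exists>c. (\<exists>i\<in>I. c i \<noteq> 0) \<and> (\<forall>k\<in>K. (\<Sum>i\<in>I. c i * A i k) = 0)"
  using assms
proof (induction K arbitrary: I A rule: finite_induct)
  case empty
  then have "I \<noteq> {}" by auto
  then show ?case by (intro exI[of _ "\<lambda>_. 1"]) auto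
next
  case (insert k K)
  show ?case
  proof (cases "\<forall>i\<in>I. A i k = 0")
    case True
    with insert.IH[of I A] insert.prems insert.hyps show ?thesis by auto
  next
    case False
    then obtain j where j: "j \<in> I" "A j k \<noteq> 0" by blast
    let ?B = "\<lambda>i l. A i l - A i k / A j k * A j l"
    have "card K < card (I - {j})"
      using insert.prems insert.hyps j by simp
    with insert.IH[of "I - {j}" ?B] insert.prems
    obtain c where c: "\<exists>i\<in>I - {j}. c i \<noteq> 0"
      "\<And>l. l \<in> K \<Longrightarrow> (\<Sum>i\<in>I - {j}. c i * ?B i l) = 0" by auto
    \<comment> \<open>The value of the eliminated unknown is \<open>- s\<close>, read off from
      equation \<open>k\<close>.\<close>
    define s where "s = (\<Sum>i\<in>I - {j}. c i * A i k / A j k)"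
    define c' where "c' = c(j := - s)"
    have sum: "(\<Sum>i\<in>I. c' i * A i l) = (\<Sum>i\<in>I - {j}. c i * A i l) - s * A j l" for l
    proof -
      have "(\<Sum>i\<in>I. c' i * A i l) = c' j * A j l + (\<Sum>i\<in>I - {j}. c' i * A i l)"
        using insert.prems j by (simp add: sum.remove)
      also have "(\<Sum>i\<in>I - {j}. c' i * A i l) = (\<Sum>i\<in>I - {j}. c i * A i l)"
        by (intro sum.cong) (auto simp: c'_def)
      finally show ?thesis by (simp add: c'_def)
    qed
    have "(\<Sum>i\<in>I. c' i * A i l) = (\<Sum>i\<in>I - {j}. c i * ?B i l)" for l
      unfolding sum s_def
      by (simp add: sum_distrib_right sum_subtractf[symmetric] right_diff_distrib mult.assoc)
    moreover have "(\<Sum>i\<in>I - {j}. c i * ?B i k) = 0"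
      using j by simp
    ultimately have "\<forall>l\<in>insert k K. (\<Sum>i\<in>I. c' i * A i l) = 0"
      using c(2) by auto
    moreover have "\<exists>i\<in>I. c' i \<noteq> 0"
      using c(1) by (auto simp: c'_def)
    ultimately show ?thesis by blast
  qed
qed

text \<open>List \<open>S\<close> sorted by the value of \<open>f\<close> and pair position
  \<open>i\<close> with position \<open>i + n\<close>. If two partners agreed, the
  \<open>n + 1\<close> entries from one to the other would all share a value.\<close>

lemma pairing:
  fixes f :: "'a \<Rightarrow> 'b"
  assumes fin: "finite S" and card: "card S = 2 * n"
    and small: "\<And>s. s \<in> S \<Longrightarrow> card {t\<in>S. f t = f s} \<le> n"
  shows "\<exists>p q. S = (\<Union>i<n. {p i, q i}) \<and> (\<forall>i<n. f (p i) \<noteq> f (q i))"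
proof -
  \<comment> \<open>The values of \<open>f\<close> carry no order, so one is borrowed from an
    injection into the naturals.\<close>
  obtain g :: "'b \<Rightarrow> nat" where g: "inj_on g (f ` S)"
    using finite_imp_inj_to_nat_seg[of "f ` S"] fin by auto
  obtain ys where ys: "set ys = S" "distinct ys"
    using finite_distinct_list[OF fin] by blast
  define xs where "xs = sort_key (\<lambda>x. g (f x)) ys"
  have xs: "set xs = S" "distinct xs" "sorted (map (\<lambda>x. g (f x)) xs)"
    using ys by (auto simp: xs_def)
  have len: "length xs = 2 * n" using card xs distinct_card by metis
  have "f (xs ! i) \<noteq> f (xs ! (i + n))" if i: "i < n" for i
  proof
    assume eq: "f (xs ! i) = f (xs ! (i + n))"
    have "f (xs ! k) = f (xs ! i)" if "k \<in> {i..i + n}" for k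
    proof -
      have "g (f (xs ! i)) \<le> g (f (xs ! k))" "g (f (xs ! k)) \<le> g (f (xs ! (i + n)))"
        using sorted_nth_mono[OF xs(3), of i k] sorted_nth_mono[OF xs(3), of k "i + n"] that len i
        by auto
      then have "g (f (xs ! k)) = g (f (xs ! i))" using eq by simp
      moreover have "xs ! k \<in> S" "xs ! i \<in> S" using xs(1) len i that by auto
      ultimately show ?thesis using g by (auto dest: inj_onD)
    qed
    moreover have "xs ! k \<in> S" if "k \<in> {i..i + n}" for k
      using xs(1) len i that nth_mem[of k xs] by auto
    ultimately have sub: "(!) xs ` {i..i + n} \<subseteq> {t\<in>S. f t = f (xs ! i)}"
      by blast
    have "inj_on ((!) xs) {i..i + n}"
      using xs(2) len i by (auto simp: inj_on_def nth_eq_iff_index_eq)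
    then have "card ((!) xs ` {i..i + n}) = n + 1" by (simp add: card_image)
    then have "n + 1 \<le> card {t\<in>S. f t = f (xs ! i)}"
      using card_mono[OF _ sub] fin by simp
    moreover have "xs ! i \<in> S" using xs(1) len i by auto
    ultimately show False using small by fastforce
  qed
  moreover have "S = (\<Union>i<n. {xs ! i, xs ! (i + n)})"
  proof (intro equalityI subsetI)
    fix s assume "s \<in> S"
    then obtain k where k: "k < 2 * n" "s = xs ! k" using xs(1) len by (auto simp: in_set_conv_nth)
    show "s \<in> (\<Union>i<n. {xs ! i, xs ! (i + n)})"
    proof (cases "k < n")
      case False
      with k have "s = xs ! ((k - n) + n)" "k - n < n" by auto
      then show ?thesis by blast
    qed (use k in auto)
  next
    fix s assume "s \<in> (\<Union>i<n. {xs ! i, xs ! (i + n)})"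
    then obtain i where "i < n" "s = xs ! i \<or> s = xs ! (i + n)" by auto
    then show "s \<in> S" using xs(1) len nth_mem[of i xs] nth_mem[of "i + n" xs] by auto
  qed
  ultimately show ?thesis
    by (intro exI[of _ "\<lambda>i. xs ! i"] exI[of _ "\<lambda>i. xs ! (i + n)"]) simp
qed

subsection \<open>Bivariate polynomials\<close>

text \<open>The exponents of the monomials of total degree at most \<open>n\<close>; the cardinality
  is the dimension of that space of polynomials.\<close>

definition lattice_triangle :: "nat \<Rightarrow> (nat \<times> nat) set" where
  "lattice_triangle n = (SIGMA i:{..n}. {..n - i})"

lemma mem_lattice_triangle [simp]: "(i, j) \<in> lattice_triangle n \<longleftrightarrow> i + j \<le> n"
  by (auto simp: lattice_triangle_def)

lemma finite_lattice_triangle [simp]: "finite (lattice_triangle n)"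
  by (simp add: lattice_triangle_def)

lemma card_lattice_triangle: "card (lattice_triangle n) = (n + 1) * (n + 2) div 2"
proof -
  have "card (lattice_triangle n) = (\<Sum>i\<le>n. Suc (n - i))"
    by (simp add: lattice_triangle_def)
  also have "\<dots> = (\<Sum>i\<le>n. Suc i)"
    by (rule sum.reindex_bij_witness[of _ "\<lambda>i. n - i" "\<lambda>i. n - i"]) auto
  also have "\<dots> = (n + 1) * (n + 2) div 2"
    by (induction n) auto
  finally show ?thesis .
qed

definition poly2_of :: "(nat \<times> nat) set \<Rightarrow> (nat \<times> nat \<Rightarrow> real) \<Rightarrow> poly2" where
  "poly2_of S c = (\<Sum>(i, j)\<in>S. monom (monom (c (i, j)) i) j)"

lemma coeff_poly2_of:
  assumes "finite S"
  shows "coeff (coeff (poly2_of S c) j) i = (if (i, j) \<in> S then c (i, j) else 0)"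
proof -
  have "coeff (coeff (poly2_of S c) j) i = (\<Sum>s\<in>S. if s = (i, j) then c s else 0)"
    unfolding poly2_of_def coeff_sum by (intro sum.cong) (auto split: if_splits simp: coeff_monom)
  then show ?thesis using assms by (simp add: sum.delta)
qed

lemma poly2_eq_iff: "f = g \<longleftrightarrow> (\<forall>i j. coeff (coeff f j) i = coeff (coeff g j) i)"
  by (auto simp: poly_eq_iff)

lemma poly2_of_coeffs:
  assumes "total_degree f \<le> d"
  shows "f = poly2_of (lattice_triangle d) (\<lambda>(i, j). coeff (coeff f j) i)"
  using assms by (auto simp: poly2_eq_iff coeff_poly2_of total_degree_le_iff)

lemma total_degree_poly2_of:
  assumes "S \<subseteq> lattice_triangle d"
  shows "total_degree (poly2_of S c) \<le> d"
proof -
  have "finite S" using assms by (rule finite_subset) simp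
  then show ?thesis using assms by (auto simp: total_degree_le_iff coeff_poly2_of)
qed

section \<open>Evaluation at points\<close>

lemma eval2_add [simp]: "eval2 (f + g) a = eval2 f a + eval2 g a"
  and eval2_diff [simp]: "eval2 (f - g) a = eval2 f a - eval2 g a"
  and eval2_minus [simp]: "eval2 (- f) a = - eval2 f a"
  and eval2_mult [simp]: "eval2 (f * g) a = eval2 f a * eval2 g a"
  and eval2_power [simp]: "eval2 (f ^ n) a = eval2 f a ^ n"
  and eval2_0 [simp]: "eval2 0 a = 0"
  and eval2_smult [simp]: "eval2 (smult [:c:] f) a = c * eval2 f a"
  by (simp_all add: eval2_def)

lemma eval2_sum [simp]: "eval2 (sum f I) a = (\<Sum>i\<in>I. eval2 (f i) a)"
  by (simp add: eval2_def poly_sum)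

lemma eval2_prod [simp]: "eval2 (prod f I) a = (\<Prod>i\<in>I. eval2 (f i) a)"
  by (simp add: eval2_def poly_prod)

lemma eval2_monom [simp]: "eval2 (monom (monom c i) j) a = c * fst a ^ i * snd a ^ j"
  by (simp add: eval2_def poly_monom)

lemma eval2_poly2_of: "eval2 (poly2_of S c) a = (\<Sum>(i, j)\<in>S. c (i, j) * fst a ^ i * snd a ^ j)"
  unfolding poly2_of_def eval2_sum by (intro sum.cong) auto

lemma eval2_eq_sum:
  assumes "total_degree f \<le> d"
  shows "eval2 f a = (\<Sum>(i, j)\<in>lattice_triangle d. coeff (coeff f j) i * fst a ^ i * snd a ^ j)"
  by (subst poly2_of_coeffs[OF assms]) (auto simp: eval2_poly2_of intro!: sum.cong)

text \<open>A nonzero polynomial in \<open>y\<close> over the domain of polynomials in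
  \<open>x\<close> has finitely many roots there, whereas every constant \<open>[:y:]\<close> would
  be a root of \<open>f - g\<close>.\<close>

lemma eval2_eqI:
  assumes "\<And>a. eval2 f a = eval2 g a"
  shows "f = g"
proof (rule ccontr)
  assume "f \<noteq> g"
  define P where "P y = poly (f - g) [:y:]" for y
  have "P y = 0" for y
  proof -
    have "poly (P y) x = 0" for x
      using assms[of "(x, y)"] by (simp add: P_def eval2_def)
    then show ?thesis using poly_all_0_iff_0 by blast
  qed
  then have "(\<lambda>y. [:y:]) ` UNIV \<subseteq> {p. poly (f - g) p = 0}" by (auto simp: P_def)
  moreover have "finite {p. poly (f - g) p = 0}"
    using \<open>f \<noteq> g\<close> by (intro poly_roots_finite) simp
  moreover have "infinite ((\<lambda>y::real. [:y:]) ` UNIV)"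
    by (subst finite_image_iff) (auto simp: inj_on_def infinite_UNIV_char_0)
  ultimately show False using finite_subset by blast
qed

lemma continuous_eval2:
  assumes "continuous_on S f"
  shows "continuous_on S (\<lambda>x. eval2 p (f x))"
  using assms by (simp only: eval2_eq_sum[OF order_refl] case_prod_beta) (auto intro!: continuous_intros)

section \<open>Total degree\<close>

lemma total_degree_0 [simp]: "total_degree 0 = 0"
  using total_degree_le_iff[of 0 0] by simp

lemma total_degree_1 [simp]: "total_degree 1 = 0"
  using total_degree_le_iff[of 1 0] by (auto simp: coeff_1 split: if_splits)

lemma total_degree_add_le:
  assumes "total_degree f \<le> d" "total_degree g \<le> d"
  shows "total_degree (f + g) \<le> d"
  using assms by (simp add: total_degree_le_iff)

lemma total_degree_diff_le:
  assumes "total_degree f \<le> d" "total_degree g \<le> d"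
  shows "total_degree (f - g) \<le> d"
  using assms by (simp add: total_degree_le_iff)

lemma total_degree_smult_le:
  assumes "total_degree f \<le> d"
  shows "total_degree (smult [:c:] f) \<le> d"
  using assms by (simp add: total_degree_le_iff)

lemma total_degree_sum_le:
  assumes "\<And>i. i \<in> I \<Longrightarrow> total_degree (f i) \<le> d"
  shows "total_degree (sum f I) \<le> d"
  using assms by (auto simp: total_degree_le_iff coeff_sum intro!: sum.neutral)

lemma total_degree_mult_le:
  assumes "total_degree f \<le> d" "total_degree g \<le> e"
  shows "total_degree (f * g) \<le> d + e"
  unfolding total_degree_le_iff
proof (intro allI impI)
  fix i j assume ij: "d + e < i + j"
  have "coeff (coeff f k) l * coeff (coeff g (j - k)) (i - l) = 0" if "k \<le> j" "l \<le> i" for k l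
  proof (cases "k + l \<le> d")
    case True
    then have "e < (i - l) + (j - k)" using ij that by linarith
    then show ?thesis using assms(2) by (simp add: total_degree_le_iff)
  next
    case False
    then show ?thesis using assms(1) by (simp add: total_degree_le_iff)
  qed
  then show "coeff (coeff (f * g) j) i = 0"
    unfolding coeff_mult coeff_sum by (intro sum.neutral ballI) auto
qed

lemma total_degree_prod_le:
  assumes "finite I" "\<And>i. i \<in> I \<Longrightarrow> total_degree (f i) \<le> 1"
  shows "total_degree (prod f I) \<le> card I"
  using assms
proof (induction rule: finite_induct)
  case (insert i I)
  then show ?case using total_degree_mult_le[of "f i" 1 "prod f I" "card I"] by simp
qed simp

section \<open>Restriction to lines and homogeneous parts\<close>

definition subst2 :: "real poly \<Rightarrow> real poly \<Rightarrow> poly2 \<Rightarrow> real poly" where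
  "subst2 u v p =
     (\<Sum>(i, j)\<in>lattice_triangle (total_degree p). smult (coeff (coeff p j) i) (u ^ i * v ^ j))"

lemma poly_subst2 [simp]: "poly (subst2 u v p) t = eval2 p (poly u t, poly v t)"
  by (simp add: subst2_def eval2_eq_sum[OF order_refl] poly_sum case_prod_beta mult.assoc)

lemma degree_subst2_le:
  assumes "degree u \<le> 1" "degree v \<le> 1"
  shows "degree (subst2 u v p) \<le> total_degree p"
  unfolding subst2_def
proof (rule degree_sum_le, simp, clarify)
  fix i j assume "(i, j) \<in> lattice_triangle (total_degree p)"
  then have ij: "i + j \<le> total_degree p" by simp
  have "degree (u ^ i * v ^ j) \<le> degree (u ^ i) + degree (v ^ j)" by (rule degree_mult_le)
  also have "\<dots> \<le> degree u * i + degree v * j"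
    by (intro add_mono degree_power_le)
  also have "\<dots> \<le> 1 * i + 1 * j" using assms by (intro add_mono mult_right_mono) auto
  finally show "degree (smult (coeff (coeff p j) i) (u ^ i * v ^ j)) \<le> total_degree p"
    using ij degree_smult_le[of "coeff (coeff p j) i" "u ^ i * v ^ j"] by linarith
qed

text \<open>The degree is a parameter, not \<open>total_degree p\<close>, so that
  \<open>form d\<close> stays linear when leading terms cancel.\<close>

definition form :: "nat \<Rightarrow> poly2 \<Rightarrow> real \<Rightarrow> real \<Rightarrow> real" where
  "form d p a b = (\<Sum>i\<le>d. coeff (coeff p (d - i)) i * a ^ i * b ^ (d - i))"

text \<open>Substituting \<open>(a t, b t)\<close> puts the degree \<open>d\<close> part in front of
  \<open>t^d\<close>. This reduces multiplicativity of forms to the top coefficient of a product of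
  univariate polynomials.\<close>

lemma form_eq_coeff: "form d p a b = coeff (subst2 [:0, a:] [:0, b:] p) d"
proof -
  let ?D = "total_degree p"
  let ?g = "\<lambda>(i, j). coeff (coeff p j) i * a ^ i * b ^ j"
  have mon: "[:0, c:] ^ n = monom (c ^ n) n" for c :: real and n
    by (metis monom_0 monom_power monom_Suc mult.right_neutral One_nat_def mult_1)
  have "coeff (subst2 [:0, a:] [:0, b:] p) d =
        (\<Sum>s\<in>lattice_triangle ?D. if fst s + snd s = d then ?g s else 0)"
    unfolding subst2_def mon coeff_sum
    by (intro sum.cong) (auto simp: mult_monom)
  also have "\<dots> = (\<Sum>s\<in>{s\<in>lattice_triangle ?D. fst s + snd s = d}. ?g s)"
    by (simp add: sum.inter_filter)
  also have "\<dots> = (\<Sum>s\<in>(\<lambda>i. (i, d - i)) ` {..d}. ?g s)"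
  proof (rule sum.mono_neutral_left)
    show "\<forall>s\<in>(\<lambda>i. (i, d - i)) ` {..d} - {s \<in> lattice_triangle ?D. fst s + snd s = d}. ?g s = 0"
    proof
      fix s assume "s \<in> (\<lambda>i. (i, d - i)) ` {..d} - {s \<in> lattice_triangle ?D. fst s + snd s = d}"
      then obtain i where "s = (i, d - i)" "i \<le> d" "\<not> d \<le> ?D" by auto
      then show "?g s = 0"
        using total_degree_le_iff[of p ?D] by simp
    qed
  qed (auto simp: image_iff)
  also have "\<dots> = form d p a b"
    by (subst sum.reindex) (auto simp: inj_on_def form_def)
  finally show ?thesis by simp
qed

lemma form_add [simp]: "form d (f + g) a b = form d f a b + form d g a b"
  by (simp add: form_def distrib_right sum.distrib)

lemma form_smult [simp]: "form d (smult [:c:] f) a b = c * form d f a b"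
  by (simp add: form_def sum_distrib_left mult.assoc)

lemma form_sum: "form d (sum f I) a b = (\<Sum>i\<in>I. form d (f i) a b)"
  by (induction I rule: infinite_finite_induct) (auto simp: form_def sum.distrib distrib_right)

lemma coeff_mult_top:
  fixes p q :: "'a :: comm_semiring_0 poly"
  assumes "degree p \<le> d" "degree q \<le> e"
  shows "coeff (p * q) (d + e) = coeff p d * coeff q e"
proof -
  have "coeff (p * q) (d + e) = (\<Sum>i\<in>{d}. coeff p i * coeff q (d + e - i))"
    unfolding coeff_mult
  proof (intro sum.mono_neutral_right ballI)
    fix i assume "i \<in> {..d + e} - {d}"
    then have "d < i \<or> e < d + e - i" by auto
    then show "coeff p i * coeff q (d + e - i) = 0"
      using assms by (auto simp: coeff_eq_0)
  qed auto
  then show ?thesis by simp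
qed

lemma form_mult:
  assumes "total_degree p \<le> d" "total_degree q \<le> e"
  shows "form (d + e) (p * q) a b = form d p a b * form e q a b"
proof -
  let ?s = "subst2 [:0, a:] [:0, b:]"
  have deg: "degree (?s p) \<le> total_degree p" for p by (intro degree_subst2_le) auto
  have "?s (p * q) = ?s p * ?s q"
    by (subst poly_eq_poly_eq_iff[symmetric]) (auto simp: fun_eq_iff)
  then show ?thesis
    unfolding form_eq_coeff
    using coeff_mult_top[of "?s p" d "?s q" e] deg[of p] deg[of q] assms by auto
qed

lemma form_prod:
  assumes "finite I" "\<And>i. i \<in> I \<Longrightarrow> total_degree (f i) \<le> 1"
  shows "form (card I) (prod f I) a b = (\<Prod>i\<in>I. form 1 (f i) a b)"
  using assms
proof (induction rule: finite_induct)
  case empty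
  then show ?case by (simp add: form_def)
next
  case (insert i I)
  have "form (1 + card I) (f i * prod f I) a b = form 1 (f i) a b * form (card I) (prod f I) a b"
    using insert by (intro form_mult total_degree_prod_le) auto
  then show ?case using insert by simp
qed

text \<open>A binary form of known degree is determined by its values at \<open>b = 1\<close>. The
  case \<open>p = 0\<close> is listed because the zero polynomial has total degree 0, which cannot
  drop when \<open>d = 0\<close>.\<close>

lemma form_eq_0_imp_total_degree:
  assumes deg: "total_degree p \<le> d" and form: "\<And>a. form d p a 1 = 0"
  shows "p = 0 \<or> total_degree p < d"
proof -
  define P where "P = (\<Sum>i\<le>d. monom (coeff (coeff p (d - i)) i) i)"
  have "poly P a = form d p a 1" for a
    by (simp add: P_def form_def poly_sum poly_monom)
  then have "P = 0" using form by (metis poly_all_0_iff_0)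
  have "coeff (coeff p (d - i)) i = 0" if "i \<le> d" for i
  proof -
    have "coeff P i = (\<Sum>k\<le>d. if k = i then coeff (coeff p (d - k)) k else 0)"
      unfolding P_def coeff_sum by (intro sum.cong) auto
    then show ?thesis using that \<open>P = 0\<close> by simp
  qed
  then have top: "coeff (coeff p j) i = 0" if "i + j = d" for i j
    using that by (metis add_diff_cancel_left' le_add1)
  have vanish: "coeff (coeff p j) i = 0" if "d \<le> i + j" for i j
    using that top deg total_degree_le_iff[of p d] by (cases "i + j = d") auto
  show ?thesis
  proof (cases d)
    case 0
    then show ?thesis using vanish by (auto simp: poly2_eq_iff)
  next
    case (Suc e)
    then have "total_degree p \<le> e" using vanish by (simp add: total_degree_le_iff)
    then show ?thesis using Suc by simp
  qed
qed

text \<open>The leading forms at \<open>b = 1\<close> are nonzero univariate polynomials, so their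
  product is nonzero somewhere. Were the degree of \<open>p * q\<close> smaller, this product would
  be identically zero.\<close>

lemma total_degree_mult_ge:
  assumes "p \<noteq> 0" "q \<noteq> 0"
  shows "total_degree p + total_degree q \<le> total_degree (p * q)"
proof (rule ccontr)
  assume nle: "\<not> ?thesis"
  define top where "top p = (\<Sum>i\<le>total_degree p. monom (coeff (coeff p (total_degree p - i)) i) i)"
    for p :: poly2
  have top: "poly (top p) a = form (total_degree p) p a 1" for p a
    by (simp add: top_def form_def poly_sum poly_monom)
  have "top p \<noteq> 0" if "p \<noteq> 0" for p
    using form_eq_0_imp_total_degree[of p "total_degree p"] top[of p] that by fastforce
  then have "top p * top q \<noteq> 0" using assms by simp
  then obtain a where "poly (top p * top q) a \<noteq> 0" using poly_all_0_iff_0 by blast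
  then have "form (total_degree p + total_degree q) (p * q) a 1 \<noteq> 0"
    by (simp add: form_mult top)
  moreover have "form (total_degree p + total_degree q) (p * q) a 1 = 0"
  proof -
    have "coeff (coeff (p * q) j) i = 0" if "i + j = total_degree p + total_degree q" for i j
      using nle that total_degree_le_iff[of "p * q" "total_degree (p * q)"] by simp
    then show ?thesis by (simp add: form_def)
  qed
  ultimately show False by simp
qed

lemma total_degree_eq_0D:
  assumes "total_degree p = 0"
  obtains c where "p = [:[:c:]:]"
proof
  show "p = [:[:coeff (coeff p 0) 0:]:]"
    using assms total_degree_le_iff[of p 0]
    by (auto simp: poly2_eq_iff coeff_pCons split: nat.splits)
qed

section \<open>Linear polynomials, gradients and Taylor expansion\<close>

definition lin :: "real \<Rightarrow> real \<Rightarrow> real \<Rightarrow> poly2" where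
  "lin \<alpha> \<beta> \<gamma> = [:[:\<gamma>, \<alpha>:], [:\<beta>:]:]"

lemma eval2_lin [simp]: "eval2 (lin \<alpha> \<beta> \<gamma>) a = \<alpha> * fst a + \<beta> * snd a + \<gamma>"
  by (simp add: lin_def eval2_def algebra_simps)

lemma total_degree_lin: "total_degree (lin \<alpha> \<beta> \<gamma>) \<le> 1"
  by (auto simp: lin_def total_degree_le_iff coeff_pCons split: nat.splits)

lemma form_lin [simp]: "form (Suc 0) (lin \<alpha> \<beta> \<gamma>) a b = \<alpha> * a + \<beta> * b"
  by (simp add: form_def lin_def)

lemma total_degree_le_1E:
  assumes "total_degree p \<le> 1"
  obtains \<alpha> \<beta> \<gamma> where "p = lin \<alpha> \<beta> \<gamma>"
proof
  show "p = lin (coeff (coeff p 0) 1) (coeff (coeff p 1) 0) (coeff (coeff p 0) 0)"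
    using assms
    by (auto simp: lin_def poly2_eq_iff coeff_pCons total_degree_le_iff split: nat.splits)
qed

lemma partial_x_add [simp]: "partial_x (f + g) = partial_x f + partial_x g"
  by (simp add: partial_x_def poly_eq_iff coeff_map_poly pderiv_add)

lemma partial_x_smult [simp]: "partial_x (smult [:c:] f) = smult [:c:] (partial_x f)"
  by (simp add: partial_x_def poly_eq_iff coeff_map_poly pderiv_smult)

lemma pderiv_sum: "pderiv (sum f I) = (\<Sum>i\<in>I. pderiv (f i))"
  by (induction I rule: infinite_finite_induct) (simp_all add: pderiv_add)

lemma partial_x_mult: "partial_x (f * g) = f * partial_x g + partial_x f * g"
proof (rule poly_eqI)
  have [simp]: "pderiv (p * q) = p * pderiv q + pderiv p * q" for p q :: "real poly"
    by (simp add: pderiv_mult mult.commute)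
  fix n
  have "coeff (partial_x (f * g)) n = (\<Sum>i\<le>n. pderiv (coeff f i * coeff g (n - i)))"
    by (simp add: partial_x_def coeff_map_poly coeff_mult pderiv_sum)
  also have "\<dots> = coeff (f * partial_x g + partial_x f * g) n"
    by (simp add: partial_x_def coeff_map_poly coeff_mult sum.distrib)
  finally show "coeff (partial_x (f * g)) n = coeff (f * partial_x g + partial_x f * g) n" .
qed

lemma partial_y_add [simp]: "partial_y (f + g) = partial_y f + partial_y g"
  by (simp add: partial_y_def pderiv_add)

lemma partial_y_smult [simp]: "partial_y (smult [:c:] f) = smult [:c:] (partial_y f)"
  by (simp add: partial_y_def pderiv_smult pderiv_pCons)

lemma partial_y_mult: "partial_y (f * g) = f * partial_y g + partial_y f * g"
  by (simp add: partial_y_def pderiv_mult mult.commute)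

lemma partial_x_lin [simp]: "partial_x (lin \<alpha> \<beta> \<gamma>) = lin 0 0 \<alpha>"
  by (auto simp: partial_x_def lin_def poly_eq_iff coeff_map_poly coeff_pCons pderiv_pCons
      split: nat.splits)

lemma partial_y_lin [simp]: "partial_y (lin \<alpha> \<beta> \<gamma>) = lin 0 0 \<beta>"
  by (simp add: partial_y_def lin_def pderiv_pCons)

lemma gradient_add: "gradient (f + g) a = gradient f a + gradient g a"
  by (simp add: gradient_def)

lemma gradient_smult: "gradient (smult [:c:] f) a = c *\<^sub>R gradient f a"
  by (simp add: gradient_def)

lemma gradient_mult:
  "gradient (f * g) a = eval2 f a *\<^sub>R gradient g a + eval2 g a *\<^sub>R gradient f a"
  by (simp add: gradient_def partial_x_mult partial_y_mult mult.commute)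

lemma gradient_lin: "gradient (lin \<alpha> \<beta> \<gamma>) a = (\<alpha>, \<beta>)"
  by (simp add: gradient_def)

text \<open>Divide by \<open>y - snd w\<close>, then divide the remainder, a polynomial in
  \<open>x\<close>, by \<open>x - fst w\<close>. Differentiating the result at \<open>w\<close>
  identifies the values of the two quotients.\<close>

lemma hadamard:
  obtains a b where
    "p = lin 0 0 (eval2 p w) + lin 1 0 (- fst w) * a + lin 0 1 (- snd w) * b"
    "gradient p w = (eval2 a w, eval2 b w)"
proof -
  define r where "r = poly p [:snd w:]"
  have "poly (p - [:r:]) [:snd w:] = 0" by (simp add: r_def)
  then obtain b where b: "p - [:r:] = [:- [:snd w:], 1:] * b"
    unfolding poly_eq_0_iff_dvd dvd_def by blast
  have "poly (r - [:poly r (fst w):]) (fst w) = 0" by simp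
  then obtain s where s: "r - [:poly r (fst w):] = [:- fst w, 1:] * s"
    unfolding poly_eq_0_iff_dvd dvd_def by blast
  define a where "a = [:s:]"
  have ev: "eval2 p w = poly r (fst w)" by (simp add: eval2_def r_def)
  have r: "[:r:] = [:[:poly r (fst w):]:] + [:[:- fst w, 1:]:] * a"
    using s by (simp add: a_def algebra_simps)
  have p: "p = lin 0 0 (eval2 p w) + lin 1 0 (- fst w) * a + lin 0 1 (- snd w) * b"
    using b r unfolding ev lin_def by (simp add: algebra_simps one_pCons)
  have "gradient p w = (eval2 a w, eval2 b w)"
    by (subst p) (simp add: gradient_add gradient_mult gradient_lin)
  with p show thesis using that by blast
qed

text \<open>The two quotients of \<open>hadamard\<close> take the partial derivatives as values at
  \<open>w\<close>, hence vanish there and can be expanded once more.\<close>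

lemma singular_decomposition:
  assumes "eval2 p w = 0" "gradient p w = 0"
  obtains a b c where
    "p = (lin 1 0 (- fst w))\<^sup>2 * a + lin 1 0 (- fst w) * lin 0 1 (- snd w) * b
         + (lin 0 1 (- snd w))\<^sup>2 * c"
proof -
  let ?X = "lin 1 0 (- fst w)" and ?Y = "lin 0 1 (- snd w)"
  have lin0: "lin 0 0 0 = 0" by (simp add: lin_def)
  obtain a b where p: "p = ?X * a + ?Y * b" "eval2 a w = 0" "eval2 b w = 0"
    using hadamard[of p w] assms lin0 by (metis add_0 fst_conv snd_conv zero_prod_def)
  obtain a1 a2 where a: "a = ?X * a1 + ?Y * a2"
    using hadamard[of a w] p(2) lin0 by (metis add_0)
  obtain b1 b2 where b: "b = ?X * b1 + ?Y * b2"
    using hadamard[of b w] p(3) lin0 by (metis add_0)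
  have "p = ?X\<^sup>2 * a1 + ?X * ?Y * (a2 + b1) + ?Y\<^sup>2 * b2"
    unfolding p(1) a b by (simp add: algebra_simps power2_eq_square)
  then show thesis by (rule that)
qed

section \<open>Dimension counts, joining lines, degrees in sums of squares\<close>

lemma dependent_family:
  assumes "finite I" "\<And>i. i \<in> I \<Longrightarrow> total_degree (v i) \<le> d" "card (lattice_triangle d) < card I"
  obtains c where "\<exists>i\<in>I. c i \<noteq> 0" "(\<Sum>i\<in>I. smult [:c i:] (v i)) = 0"
proof -
  obtain c where c: "\<exists>i\<in>I. c i \<noteq> 0"
    "\<forall>s\<in>lattice_triangle d. (\<Sum>i\<in>I. c i * coeff (coeff (v i) (snd s)) (fst s)) = 0"
    using underdetermined_system[of "lattice_triangle d" I "\<lambda>i s. coeff (coeff (v i) (snd s)) (fst s)"]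
      assms by auto
  have "total_degree (\<Sum>i\<in>I. smult [:c i:] (v i)) \<le> d"
    using assms(2) by (intro total_degree_sum_le total_degree_smult_le)
  moreover have "coeff (coeff (\<Sum>i\<in>I. smult [:c i:] (v i)) l) k = 0" if "k + l \<le> d" for k l
    using c(2)[rule_format, of "(k, l)"] that by (simp add: coeff_sum)
  ultimately have "(\<Sum>i\<in>I. smult [:c i:] (v i)) = 0"
    unfolding poly2_eq_iff total_degree_le_iff by (metis coeff_0 not_le)
  with c(1) show thesis by (rule that)
qed

text \<open>Dual to \<open>dependent_family\<close>: there the unknowns are multipliers and the
  equations are indexed by coefficients; here the unknowns are the coefficients and each functional
  gives an equation.\<close>

lemma common_kernel:
  fixes \<phi> :: "'k \<Rightarrow> poly2 \<Rightarrow> real"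
  assumes "finite K" "card K < card (lattice_triangle d)"
    and add: "\<And>k p q. k \<in> K \<Longrightarrow> \<phi> k (p + q) = \<phi> k p + \<phi> k q"
    and smult: "\<And>k c p. k \<in> K \<Longrightarrow> \<phi> k (smult [:c:] p) = c * \<phi> k p"
  obtains p where "p \<noteq> 0" "total_degree p \<le> d" "\<And>k. k \<in> K \<Longrightarrow> \<phi> k p = 0"
proof -
  obtain c where c: "\<exists>s\<in>lattice_triangle d. c s \<noteq> 0"
    "\<forall>k\<in>K. (\<Sum>s\<in>lattice_triangle d. c s * \<phi> k (monom (monom 1 (fst s)) (snd s))) = 0"
    using underdetermined_system[of K "lattice_triangle d"
        "\<lambda>s k. \<phi> k (monom (monom 1 (fst s)) (snd s))"] assms by auto
  define p where "p = poly2_of (lattice_triangle d) c"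
  have sum: "\<phi> k (sum g S) = (\<Sum>s\<in>S. \<phi> k (g s))" if "k \<in> K" for k g and S :: "(nat \<times> nat) set"
  proof -
    have "\<phi> k 0 = 0" using smult[OF that, of 0 0] by simp
    then show ?thesis
      by (induction S rule: infinite_finite_induct) (simp_all add: add that)
  qed
  have p: "p = (\<Sum>s\<in>lattice_triangle d. smult [:c s:] (monom (monom 1 (fst s)) (snd s)))"
    by (auto simp: p_def poly2_of_def smult_monom intro!: sum.cong)
  have "\<phi> k p = 0" if "k \<in> K" for k
    using c(2) that unfolding p by (simp add: sum smult)
  moreover have "p \<noteq> 0"
  proof -
    obtain i j where "i + j \<le> d" "c (i, j) \<noteq> 0" using c(1) by auto
    then have "coeff (coeff p j) i \<noteq> 0" by (simp add: p_def coeff_poly2_of)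
    then show ?thesis by auto
  qed
  moreover have "total_degree p \<le> d" by (simp add: p_def total_degree_poly2_of)
  ultimately show thesis using that by blast
qed

definition join :: "real \<times> real \<Rightarrow> real \<times> real \<Rightarrow> poly2" where
  "join p q = lin (snd p - snd q) (fst q - fst p) (fst p * snd q - snd p * fst q)"

text \<open>This determinant is nonzero exactly when \<open>p - r\<close> and \<open>q - r\<close>
  are linearly independent, so avoiding \<open>r\<close> becomes a condition on directions seen from
  \<open>r\<close>.\<close>

lemma eval2_join:
  "eval2 (join p q) r =
     (fst p - fst r) * (snd q - snd r) - (snd p - snd r) * (fst q - fst r)"
  by (simp add: join_def algebra_simps)

lemma form_join [simp]: "form (Suc 0) (join p q) a b = (snd p - snd q) * a + (fst q - fst p) * b"
  by (simp add: join_def)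

lemma total_degree_join: "total_degree (join p q) \<le> 1"
  unfolding join_def by (rule total_degree_lin)

text \<open>Leading forms of real squares cannot cancel. If the largest degree \<open>D\<close>
  exceeded \<open>d\<close>, the degree \<open>2 D\<close> part of the sum, a sum of squares of
  degree \<open>D\<close> forms, would be zero, and so would each of these forms.\<close>

lemma sos_total_degree_le:
  assumes "total_degree (\<Sum>i<n. (q i)\<^sup>2) \<le> 2 * d" "i < (n::nat)"
  shows "total_degree (q i) \<le> d"
proof (rule ccontr)
  assume big: "\<not> total_degree (q i) \<le> d"
  define D where "D = Max ((\<lambda>i. total_degree (q i)) ` {..<n})"
  have le: "total_degree (q j) \<le> D" if "j < n" for j
    unfolding D_def using that by (intro Max_ge) auto
  have "D \<in> (\<lambda>i. total_degree (q i)) ` {..<n}"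
    unfolding D_def using assms(2) by (intro Max_in) auto
  then obtain k where k: "k < n" "total_degree (q k) = D" by auto
  have "d < D" using le[OF assms(2)] big by simp
  have "form D (q k) a 1 = 0" for a
  proof -
    have "(\<Sum>j<n. (form D (q j) a 1)\<^sup>2) = (\<Sum>j<n. form (D + D) ((q j)\<^sup>2) a 1)"
      using le by (intro sum.cong) (auto simp: power2_eq_square form_mult)
    also have "\<dots> = form (D + D) (\<Sum>j<n. (q j)\<^sup>2) a 1" by (simp add: form_sum)
    also have "\<dots> = 0"
      using assms(1) \<open>d < D\<close> by (simp add: form_def total_degree_le_iff)
    finally have "\<forall>j\<in>{..<n}. (form D (q j) a 1)\<^sup>2 = 0"
      by (simp add: sum_nonneg_eq_0_iff)
    then show ?thesis using k by simp
  qed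
  then have "q k = 0 \<or> total_degree (q k) < D"
    using form_eq_0_imp_total_degree[of "q k" D] k by simp
  then show False using k \<open>d < D\<close> by auto
qed

subsection \<open>Domination of polynomials on the plane\<close>

lemma tendsto_nhds_continuous:
  assumes "continuous_on UNIV f"
  shows "(f \<longlongrightarrow> f x) (nhds x)"
  using assms by (simp add: continuous_on_def tendsto_at_iff_tendsto_nhds)

text \<open>Near \<open>x\<close>, \<phi> exceeds half its value at \<open>x\<close> and \<psi>
  stays below a constant, so the inequality can be divided by \<phi>. The point is that
  \<open>h x = 0\<close> is allowed.\<close>

lemma local_domination:
  fixes \<phi> \<psi> f h :: "'a :: topological_space \<Rightarrow> real"
  assumes cont: "continuous_on UNIV \<phi>" "continuous_on UNIV \<psi>"
    and pos: "\<phi> x > 0" and h: "\<forall>\<^sub>F y in nhds x. h y \<ge> 0"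
    and le: "\<And>y. \<phi> y * f y \<le> \<psi> y * h y"
  shows "\<exists>C\<ge>0. \<forall>\<^sub>F y in nhds x. f y \<le> C * h y"
proof -
  define C where "C = (\<bar>\<psi> x\<bar> + 1) / (\<phi> x / 2)"
  have C: "C \<ge> 0" using pos by (simp add: C_def)
  have "\<forall>\<^sub>F y in nhds x. \<phi> x / 2 < \<phi> y"
    using order_tendstoD(1)[OF tendsto_nhds_continuous[OF cont(1)], of "\<phi> x / 2"] pos by simp
  moreover have "\<forall>\<^sub>F y in nhds x. \<psi> y < \<bar>\<psi> x\<bar> + 1"
    by (rule order_tendstoD(2)[OF tendsto_nhds_continuous[OF cont(2)]]) linarith
  ultimately have "\<forall>\<^sub>F y in nhds x. f y \<le> C * h y"
    using h
  proof eventually_elim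
    case (elim y)
    show ?case
    proof (cases "f y \<le> 0")
      case True
      then show ?thesis using mult_nonneg_nonneg[OF C elim(3)] by linarith
    next
      case False
      then have "\<phi> x / 2 * f y \<le> \<phi> y * f y" using elim by (intro mult_right_mono) auto
      also have "\<dots> \<le> \<psi> y * h y" by (rule le)
      also have "\<dots> \<le> (\<bar>\<psi> x\<bar> + 1) * h y" using elim by (intro mult_right_mono) auto
      finally show ?thesis using pos by (simp add: C_def field_simps)
    qed
  qed
  with C show ?thesis by blast
qed

text \<open>Take a finite subcover and add its constants: as they and \<open>h\<close> are
  nonnegative, the sum serves on every piece.\<close>

lemma compact_domination:
  fixes f h :: "'a :: topological_space \<Rightarrow> real"
  assumes "compact S" and h: "\<And>y. y \<in> S \<Longrightarrow> h y \<ge> 0"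
    and loc: "\<And>x. x \<in> S \<Longrightarrow> \<exists>C\<ge>0. \<forall>\<^sub>F y in nhds x. f y \<le> C * h y"
  shows "\<exists>C\<ge>0. \<forall>y\<in>S. f y \<le> C * h y"
proof -
  obtain C where C: "\<And>x. x \<in> S \<Longrightarrow> C x \<ge> 0"
    "\<And>x. x \<in> S \<Longrightarrow> \<forall>\<^sub>F y in nhds x. f y \<le> C x * h y"
    using loc by metis
  obtain U where U: "\<And>x. x \<in> S \<Longrightarrow> open (U x)" "\<And>x. x \<in> S \<Longrightarrow> x \<in> U x"
    "\<And>x y. x \<in> S \<Longrightarrow> y \<in> U x \<Longrightarrow> f y \<le> C x * h y"
    using C(2) unfolding eventually_nhds by metis
  have "S \<subseteq> (\<Union>x\<in>S. U x)" using U(2) by auto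
  with \<open>compact S\<close> U(1) obtain T where T: "T \<subseteq> S" "finite T" "S \<subseteq> (\<Union>x\<in>T. U x)"
    by (rule compactE_image)
  have "f y \<le> sum C T * h y" if y: "y \<in> S" for y
  proof -
    obtain x where x: "x \<in> T" "y \<in> U x" using T y by blast
    then have "C x \<le> sum C T" using T C(1) by (intro member_le_sum) auto
    then have "C x * h y \<le> sum C T * h y" using h[OF y] by (intro mult_right_mono)
    moreover have "f y \<le> C x * h y" using U(3) x T(1) by blast
    ultimately show ?thesis by linarith
  qed
  moreover have "sum C T \<ge> 0" using T C(1) by (intro sum_nonneg) auto
  ultimately show ?thesis by blast
qed

text \<open>Homogenization to a prescribed degree, so that two polynomials of different degrees are
  scaled by the same power of the last coordinate and can be compared.\<close>

definition hom :: "nat \<Rightarrow> poly2 \<Rightarrow> real \<times> real \<times> real \<Rightarrow> real" where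
  "hom d p x = (\<Sum>(i, j)\<in>lattice_triangle d.
     coeff (coeff p j) i * fst x ^ i * fst (snd x) ^ j * snd (snd x) ^ (d - i - j))"

lemma continuous_hom: "continuous_on S (hom d p)"
  unfolding hom_def[abs_def] case_prod_beta by (intro continuous_intros)

lemma hom_affine:
  assumes "total_degree p \<le> d" "s \<noteq> 0"
  shows "hom d p (u, v, s) = s ^ d * eval2 p (u / s, v / s)"
proof -
  have "c * u ^ i * v ^ j * s ^ (d - i - j) = s ^ d * (c * (u / s) ^ i * (v / s) ^ j)"
    if "i + j \<le> d" for c i j
  proof -
    have "s ^ d = s ^ i * s ^ j * s ^ (d - i - j)"
      using that by (simp flip: power_add)
    then show ?thesis using assms(2) by (simp add: power_divide)
  qed
  then show ?thesis
    unfolding hom_def eval2_eq_sum[OF assms(1)] sum_distrib_left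
    by (intro sum.cong) auto
qed

lemma hom_eq_double_sum:
  "hom d p (u, v, s) =
     (\<Sum>i\<le>d. \<Sum>j\<le>d - i. coeff (coeff p j) i * u ^ i * v ^ j * s ^ (d - i - j))"
  unfolding hom_def lattice_triangle_def by (simp add: sum.Sigma)

lemma hom_infinity: "hom d p (u, v, 0) = form d p u v"
  unfolding hom_eq_double_sum form_def
proof (intro sum.cong refl)
  fix i assume "i \<in> {..d}"
  have "(\<Sum>j\<le>d - i. coeff (coeff p j) i * u ^ i * v ^ j * 0 ^ (d - i - j)) =
      (\<Sum>j\<in>{d - i}. coeff (coeff p j) i * u ^ i * v ^ j * 0 ^ (d - i - j))"
    by (rule sum.mono_neutral_right) auto
  then show "(\<Sum>j\<le>d - i. coeff (coeff p j) i * u ^ i * v ^ j * 0 ^ (d - i - j)) =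
        coeff (coeff p (d - i)) i * u ^ i * v ^ (d - i)" by simp
qed

lemma homogenization_infinity: "homogenization f a b 0 = form (total_degree f) f a b"
  by (simp only: homogenization_def Let_def hom_infinity[symmetric] hom_eq_double_sum)

text \<open>
  Homogenizing turns the plane into an open hemisphere, so that compactness of the sphere covers
  the behaviour at infinity as well.
\<close>

lemma global_domination:
  assumes deg: "total_degree E \<le> d" "total_degree g \<le> d"
    and E: "\<And>a. eval2 E a \<ge> 0"
    and infinity: "\<And>a b. (a, b) \<noteq> (0, 0) \<Longrightarrow> form d E a b > 0"
    and loc: "\<And>p. \<exists>C\<ge>0. \<forall>\<^sub>F a in nhds p. eval2 g a \<le> C * eval2 E a"
    and "even d"
  shows "\<exists>C\<ge>0. \<forall>a. eval2 g a \<le> C * eval2 E a"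
proof -
  let ?S = "sphere (0 :: real \<times> real \<times> real) 1"
  \<comment> \<open>Points of the sphere may have a negative last coordinate; evenness of
    \<open>d\<close> keeps the scaling from reversing inequalities.\<close>
  have pow: "s ^ d \<ge> 0" for s :: real using \<open>even d\<close> by (rule zero_le_even_power)
  have "\<exists>C\<ge>0. \<forall>y\<in>?S. hom d g y \<le> C * hom d E y"
  proof (rule compact_domination)
    fix x assume x: "x \<in> ?S"
    obtain u v s where xs: "x = (u, v, s)" by (cases x)
    have "hom d E x \<ge> 0 \<and> (\<exists>C\<ge>0. \<forall>\<^sub>F y in nhds x. hom d g y \<le> C * hom d E y)"
    proof (cases "s = 0")
      case True
      then have "(u, v) \<noteq> (0, 0)" using x xs by (auto simp: norm_Pair)
      then have pos: "hom d E x > 0" using infinity True xs by (simp add: hom_infinity)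
      have "\<forall>\<^sub>F y in nhds x. hom d E y > 0"
        using order_tendstoD(1)[OF tendsto_nhds_continuous[OF continuous_hom] pos] .
      then have "\<forall>\<^sub>F y in nhds x. hom d E y \<ge> 0" by eventually_elim simp
      \<comment> \<open>With \<open>hom d E\<close> for \<phi> and \<open>hom d g\<close> for
        \<psi>, the required inequality is an equality.\<close>
      then have "\<exists>C\<ge>0. \<forall>\<^sub>F y in nhds x. hom d g y \<le> C * hom d E y"
        by (rule local_domination[OF continuous_hom[of _ d E] continuous_hom[of _ d g] pos])
          (simp add: mult.commute)
      then show ?thesis using pos by simp
    next
      case False
      \<comment> \<open>The chart from homogeneous coordinates back to the plane.\<close>
      define m :: "real \<times> real \<times> real \<Rightarrow> real \<times> real"
        where "m = (\<lambda>y. (fst y / snd (snd y), fst (snd y) / snd (snd y)))"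
      have hom: "hom d p y = snd (snd y) ^ d * eval2 p (m y)"
        if "snd (snd y) \<noteq> 0" "total_degree p \<le> d" for y p
        using hom_affine[OF that(2,1), of "fst y" "fst (snd y)"] by (simp add: m_def)
      have "((\<lambda>y. y) \<longlongrightarrow> x) (nhds x)" by (rule filterlim_ident)
      then have "(m \<longlongrightarrow> m x) (nhds x)"
        unfolding m_def using False xs
        by (intro tendsto_Pair tendsto_divide tendsto_fst tendsto_snd) simp_all
      moreover obtain C where C: "C \<ge> 0" "\<forall>\<^sub>F a in nhds (m x). eval2 g a \<le> C * eval2 E a"
        using loc by blast
      ultimately have ev: "\<forall>\<^sub>F y in nhds x. eval2 g (m y) \<le> C * eval2 E (m y)"
        by (auto simp: filterlim_iff)
      have "continuous_on UNIV (\<lambda>y :: real \<times> real \<times> real. snd (snd y))" by (intro continuous_intros)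
      then have "\<forall>\<^sub>F y in nhds x. snd (snd y) \<noteq> 0"
        using tendsto_imp_eventually_ne[OF tendsto_nhds_continuous, of "\<lambda>y. snd (snd y)" x 0] False xs
        by simp
      with ev have "\<forall>\<^sub>F y in nhds x. hom d g y \<le> C * hom d E y"
      proof eventually_elim
        case (elim y)
        then show ?case
          using mult_left_mono[OF elim(1) pow[of "snd (snd y)"]] deg
          by (simp add: hom mult.left_commute)
      qed
      moreover have "hom d E x \<ge> 0" using hom[of x E] False xs deg E pow by simp
      ultimately show ?thesis using C by blast
    qed
    then show "hom d E x \<ge> 0" "\<exists>C\<ge>0. \<forall>\<^sub>F y in nhds x. hom d g y \<le> C * hom d E y" by auto
  qed simp
  then obtain C where C: "C \<ge> 0" "\<And>y. y \<in> ?S \<Longrightarrow> hom d g y \<le> C * hom d E y" by blast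
  have "eval2 g (a, b) \<le> C * eval2 E (a, b)" for a b
  proof -
    \<comment> \<open>Radial projection of \<open>(a, b, 1)\<close> to the sphere.\<close>
    define r where "r = norm (a, b, 1 :: real)"
    have r: "r > 0" by (simp add: r_def zero_prod_def)
    let ?y = "(a / r, b / r, 1 / r)"
    have "?y = (1 / r) *\<^sub>R (a, b, 1)" by simp
    then have "norm ?y = \<bar>1 / r\<bar> * r" by (simp only: norm_scaleR r_def)
    then have "?y \<in> ?S" using r by simp
    then have "hom d g ?y \<le> C * hom d E ?y" by (rule C(2))
    then have "(1 / r) ^ d * eval2 g (a, b) \<le> (1 / r) ^ d * (C * eval2 E (a, b))"
      using r by (simp add: hom_affine[OF deg(1)] hom_affine[OF deg(2)] mult.left_commute)
    moreover have "(1 / r) ^ d > 0" using r by simp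
    ultimately show ?thesis by (rule mult_left_le_imp_le)
  qed
  then show ?thesis using C(1) by auto
qed

text \<open>With \<open>f1\<close> and \<open>f2\<close> expanded in the coordinates
  \<open>x\<close>, \<open>y\<close> centred at \<open>w\<close>, Cramer's rule recovers
  \<open>x\<close> and \<open>y\<close> up to a determinant that is nonzero at \<open>w\<close>.
  Hence \<open>x^2 + y^2\<close> is locally bounded by a multiple of \<open>f1^2 + f2^2\<close>, and
  the singular \<open>g\<close> is bounded by a multiple of \<open>x^2 + y^2\<close>.\<close>

lemma domination_at_node:
  assumes van: "eval2 f1 w = 0" "eval2 f2 w = 0"
    and indep: "fst (gradient f1 w) * snd (gradient f2 w) - fst (gradient f2 w) * snd (gradient f1 w) \<noteq> 0"
    and g: "eval2 g w = 0" "gradient g w = 0"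
  shows "\<exists>C\<ge>0. \<forall>\<^sub>F a in nhds w. eval2 g a \<le> C * eval2 (f1\<^sup>2 + f2\<^sup>2) a"
proof -
  let ?X = "lin 1 0 (- fst w)" and ?Y = "lin 0 1 (- snd w)"
  have lin0: "lin 0 0 0 = 0" by (simp add: lin_def)
  obtain a1 b1 where f1: "f1 = ?X * a1 + ?Y * b1" "gradient f1 w = (eval2 a1 w, eval2 b1 w)"
    using hadamard[of f1 w] van(1) lin0 by (metis add_0)
  obtain a2 b2 where f2: "f2 = ?X * a2 + ?Y * b2" "gradient f2 w = (eval2 a2 w, eval2 b2 w)"
    using hadamard[of f2 w] van(2) lin0 by (metis add_0)
  obtain a b c where g: "g = ?X\<^sup>2 * a + ?X * ?Y * b + ?Y\<^sup>2 * c"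
    using singular_decomposition[OF g] .
  define \<phi> where "\<phi> r = (eval2 (a1 * b2 - a2 * b1) r)\<^sup>2" for r
  define N where "N r = eval2 (a1\<^sup>2 + b1\<^sup>2 + a2\<^sup>2 + b2\<^sup>2) r" for r
  define G where "G r = \<bar>eval2 a r\<bar> + \<bar>eval2 b r\<bar> + \<bar>eval2 c r\<bar>" for r
  have cont: "continuous_on UNIV (eval2 p)" for p
    using continuous_eval2[OF continuous_on_id, of UNIV p] by simp
  show ?thesis
  proof (rule local_domination)
    show "continuous_on UNIV \<phi>" "continuous_on UNIV (\<lambda>r. N r * G r)"
      unfolding \<phi>_def N_def G_def using cont by (auto intro!: continuous_intros)
    show "\<phi> w > 0" using indep by (simp add: \<phi>_def f1(2) f2(2))
    show "\<forall>\<^sub>F r in nhds w. eval2 (f1\<^sup>2 + f2\<^sup>2) r \<ge> 0" by simp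
    fix r
    define x y where "x = eval2 ?X r" and "y = eval2 ?Y r"
    have "eval2 g r \<le> (x\<^sup>2 + y\<^sup>2) * G r"
    proof -
      have 1: "x\<^sup>2 * eval2 a r \<le> (x\<^sup>2 + y\<^sup>2) * \<bar>eval2 a r\<bar>" "y\<^sup>2 * eval2 c r \<le> (x\<^sup>2 + y\<^sup>2) * \<bar>eval2 c r\<bar>"
        by (rule order_trans[OF mult_left_mono[OF abs_ge_self] mult_right_mono]; simp)+
      have "\<bar>x * y\<bar> \<le> x\<^sup>2 + y\<^sup>2"
        using sum_squares_bound[of "\<bar>x\<bar>" "\<bar>y\<bar>"] mult_nonneg_nonneg[of "\<bar>x\<bar>" "\<bar>y\<bar>"]
        unfolding abs_mult power2_abs by linarith
      then have "\<bar>x * y\<bar> * \<bar>eval2 b r\<bar> \<le> (x\<^sup>2 + y\<^sup>2) * \<bar>eval2 b r\<bar>" by (rule mult_right_mono) simp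
      then have "x * y * eval2 b r \<le> (x\<^sup>2 + y\<^sup>2) * \<bar>eval2 b r\<bar>"
        using abs_ge_self[of "x * y * eval2 b r"] by (simp add: abs_mult)
      with 1 show ?thesis unfolding g G_def x_def y_def by (simp add: algebra_simps)
    qed
    then have "\<phi> r * eval2 g r \<le> \<phi> r * ((x\<^sup>2 + y\<^sup>2) * G r)"
      by (intro mult_left_mono) (simp_all add: \<phi>_def)
    also have "\<dots> = (\<phi> r * (x\<^sup>2 + y\<^sup>2)) * G r" by simp
    also have "\<dots> \<le> (N r * eval2 (f1\<^sup>2 + f2\<^sup>2) r) * G r"
    proof (rule mult_right_mono)
      show "\<phi> r * (x\<^sup>2 + y\<^sup>2) \<le> N r * eval2 (f1\<^sup>2 + f2\<^sup>2) r"
      proof -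
      define A1 B1 A2 B2 where "A1 = eval2 a1 r" "B1 = eval2 b1 r" "A2 = eval2 a2 r" "B2 = eval2 b2 r"
      note D = this
      define F1 F2 where "F1 = x * A1 + y * B1" "F2 = x * A2 + y * B2"
      note F = this
      have cs: "(p * t - q * s)\<^sup>2 \<le> (p\<^sup>2 + q\<^sup>2) * (s\<^sup>2 + t\<^sup>2)" for p q s t :: real
        using zero_le_power2[of "p * s + q * t"] by (simp add: power2_eq_square algebra_simps)
      \<comment> \<open>Cramer's rule for the system \<open>F1 = x * A1 + y * B1\<close>,
        \<open>F2 = x * A2 + y * B2\<close>; each right side is then bounded by Cauchy-Schwarz
        (\<open>cs\<close>).\<close>
      have "x * (A1 * B2 - A2 * B1) = F1 * B2 - F2 * B1" "y * (A1 * B2 - A2 * B1) = F2 * A1 - F1 * A2"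
        by (simp_all add: F algebra_simps)
      moreover have "(A1 * B2 - A2 * B1)\<^sup>2 * (x\<^sup>2 + y\<^sup>2) =
          (x * (A1 * B2 - A2 * B1))\<^sup>2 + (y * (A1 * B2 - A2 * B1))\<^sup>2"
        by algebra
      ultimately have "(A1 * B2 - A2 * B1)\<^sup>2 * (x\<^sup>2 + y\<^sup>2) = (F1 * B2 - F2 * B1)\<^sup>2 + (F2 * A1 - F1 * A2)\<^sup>2"
        by simp
      also have "\<dots> \<le> (F1\<^sup>2 + F2\<^sup>2) * (B1\<^sup>2 + B2\<^sup>2) + (F2\<^sup>2 + F1\<^sup>2) * (A2\<^sup>2 + A1\<^sup>2)"
        by (intro add_mono cs)
      also have "\<dots> = (A1\<^sup>2 + B1\<^sup>2 + A2\<^sup>2 + B2\<^sup>2) * (F1\<^sup>2 + F2\<^sup>2)" by (simp add: algebra_simps)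
      finally show ?thesis
        unfolding \<phi>_def N_def f1(1) f2(1) by (simp add: D F x_def y_def)
      qed
    qed (simp add: G_def)
    finally show "\<phi> r * eval2 g r \<le> N r * G r * eval2 (f1\<^sup>2 + f2\<^sup>2) r"
      by (simp only: ac_simps)
  qed
qed

subsection \<open>Nine common zeros of two cubics\<close>

text \<open>Labels directions by a single value, for use in \<open>pairing\<close>. Division by zero
  gives slope 0 to vertical vectors, so the flag is what tells them from horizontal ones.\<close>

lemma same_direction_iff:
  fixes u1 u2 v1 v2 :: real
  assumes "(u1, u2) \<noteq> (0, 0)" "(v1, v2) \<noteq> (0, 0)"
  shows "(u1 = 0, u2 / u1) = (v1 = 0, v2 / v1) \<longleftrightarrow> u1 * v2 = u2 * v1"
  using assms by (cases "u1 = 0"; cases "v1 = 0") (auto simp: frac_eq_eq mult.commute)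

text \<open>A nonzero binary quadratic form vanishes on at most two lines through the origin.
  \<open>?D\<close> is, up to sign, the Vandermonde-type determinant of the three equations.\<close>

lemma binary_quadratic_eq_0:
  fixes A B C :: real
  assumes "A * u1\<^sup>2 + B * (u1 * v1) + C * v1\<^sup>2 = 0" "A * u2\<^sup>2 + B * (u2 * v2) + C * v2\<^sup>2 = 0"
    "A * u3\<^sup>2 + B * (u3 * v3) + C * v3\<^sup>2 = 0"
    and nz: "u1 * v2 \<noteq> v1 * u2" "u1 * v3 \<noteq> v1 * u3" "u2 * v3 \<noteq> v2 * u3"
  shows "A = 0" "B = 0" "C = 0"
proof -
  let ?D = "(u1 * v2 - v1 * u2) * (u1 * v3 - v1 * u3) * (u2 * v3 - v2 * u3)"
  have "A * ?D = 0" "B * ?D = 0" "C * ?D = 0" using assms(1-3) by algebra+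
  moreover have "?D \<noteq> 0" using nz by simp
  ultimately show "A = 0" "B = 0" "C = 0" using mult_eq_0_iff by blast+
qed

locale nine_points =
  fixes f1 f2 :: poly2 and Z :: "(real \<times> real) set"
  assumes deg1: "total_degree f1 = 3" and deg2: "total_degree f2 = 3"
    and coprime: "coprime f1 f2"
    and Z_eq: "Z = {a. eval2 f1 a = 0 \<and> eval2 f2 a = 0}"
    and card_Z: "card Z = 9"
begin

section \<open>Syzygies of the two cubics and ideal membership\<close>

lemma finite_Z: "finite Z"
  using card_Z card.infinite by fastforce

lemma nonzero: "f1 \<noteq> 0" "f2 \<noteq> 0"
  using deg1 deg2 by auto

lemma eval2_Z: "p \<in> Z \<Longrightarrow> eval2 f1 p = 0" "p \<in> Z \<Longrightarrow> eval2 f2 p = 0"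
  by (auto simp: Z_eq)

text \<open>Coprimality makes \<open>f1\<close> divide \<open>b\<close>, and the degree bound leaves
  only a constant quotient: all such relations are multiples of the Koszul relation.\<close>

lemma syzygy:
  assumes "a * f1 + b * f2 = 0" "total_degree b \<le> 3"
  obtains t where "a = smult [:- t:] f2" "b = smult [:t:] f1"
proof -
  have "b * f2 = (- a) * f1"
    using assms(1) by (simp add: add_eq_0_iff)
  then have "f1 dvd b * f2" by simp
  then have "f1 dvd b" using coprime by (simp add: coprime_dvd_mult_left_iff)
  then obtain k where k: "b = f1 * k" by (auto simp: dvd_def)
  have "total_degree k = 0"
    using total_degree_mult_ge[of f1 k] nonzero assms(2) deg1 k by (cases "k = 0") auto
  then obtain t where "k = [:[:t:]:]" by (rule total_degree_eq_0D)
  then have b: "b = smult [:t:] f1" using k by simp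
  have "f1 * (a + smult [:t:] f2) = 0"
    using assms(1) by (simp add: b algebra_simps)
  then have "a = smult [:- t:] f2"
    using nonzero by (simp add: add_eq_0_iff)
  then show thesis using b that by blast
qed

lemma syzygy_low_degree:
  assumes "a * f1 + b * f2 = 0" "total_degree b \<le> 2"
  shows "a = 0" "b = 0"
proof -
  have "total_degree b \<le> 3" using assms by simp
  with assms(1) obtain t where t: "a = smult [:- t:] f2" "b = smult [:t:] f1" by (rule syzygy)
  have "t = 0"
  proof (rule ccontr)
    assume "t \<noteq> 0"
    then have "f1 = smult [:1 / t:] b" using t by (simp add: one_pCons[symmetric])
    then have "total_degree f1 \<le> 2" using assms(2) total_degree_smult_le by metis
    then show False using deg1 by simp
  qed
  then show "a = 0" "b = 0" using t by simp_all
qed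

text \<open>Multiples of \<open>f1\<close>, multiples of \<open>f2\<close> by monomials from
  \<open>M\<close>, nine separators and \<open>g\<close> outnumber the dimension of degree
  \<open>k + 3\<close>, so they satisfy a linear relation; the 10 counts the separators and
  \<open>g\<close>. Restricting the multipliers of \<open>f2\<close> to \<open>M\<close> allows the
  Koszul relation to be excluded when \<open>k = 3\<close>.\<close>

lemma noether_aux:
  assumes M: "M \<subseteq> lattice_triangle k" "total_degree g \<le> k + 3"
    and card: "card (lattice_triangle (k + 3)) < card (lattice_triangle k) + card M + 10"
    and indep: "\<And>a c. a * f1 + poly2_of M c * f2 = 0 \<Longrightarrow> a = 0 \<and> poly2_of M c = 0"
    and sep: "\<And>p. p \<in> Z \<Longrightarrow>
      \<exists>e. total_degree e \<le> k + 3 \<and> eval2 e p \<noteq> 0 \<and> (\<forall>q\<in>Z - {p}. eval2 e q = 0)"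
    and van: "\<And>p. p \<in> Z \<Longrightarrow> eval2 g p = 0"
  obtains a b where "total_degree a \<le> k" "total_degree b \<le> k" "g = a * f1 + b * f2"
proof -
  have finM: "finite M" using M by (rule_tac finite_subset) auto
  obtain e where e: "\<And>p. p \<in> Z \<Longrightarrow> total_degree (e p) \<le> k + 3"
    "\<And>p. p \<in> Z \<Longrightarrow> eval2 (e p) p \<noteq> 0"
    "\<And>p q. p \<in> Z \<Longrightarrow> q \<in> Z \<Longrightarrow> q \<noteq> p \<Longrightarrow> eval2 (e p) q = 0"
    using sep by (metis DiffI singletonD)
  let ?mono = "\<lambda>(i, j). monom (monom (1::real) i) j"
  let ?I = "lattice_triangle k <+> (M <+> (Z <+> {()}))"
  let ?v = "case_sum (\<lambda>s. ?mono s * f1) (case_sum (\<lambda>s. ?mono s * f2) (case_sum e (\<lambda>_. g)))"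
  have mono: "total_degree (?mono s) \<le> k" if "s \<in> lattice_triangle k" for s
    using that by (cases s) (auto simp: total_degree_le_iff)
  have "total_degree (?v i) \<le> k + 3" if "i \<in> ?I" for i
    using that mono M e(1) total_degree_mult_le[of _ k f1 3] total_degree_mult_le[of _ k f2 3]
      deg1 deg2 by (auto simp del: mem_lattice_triangle)
  moreover have "card ?I = card (lattice_triangle k) + card M + 10"
    using finM finite_Z card_Z by (simp add: card_Plus)
  ultimately obtain c where c: "\<exists>i\<in>?I. c i \<noteq> 0" "(\<Sum>i\<in>?I. smult [:c i:] (?v i)) = 0"
    using dependent_family[of ?I ?v "k + 3"] finM finite_Z card by auto
  define a where "a = poly2_of (lattice_triangle k) (\<lambda>s. c (Inl s))"
  define b where "b = poly2_of M (\<lambda>s. c (Inr (Inl s)))"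
  define cZ where "cZ p = c (Inr (Inr (Inl p)))" for p
  define cg where "cg = c (Inr (Inr (Inr ())))"
  have mult: "(\<Sum>s\<in>S. smult [:d s:] (?mono s * f)) = poly2_of S d * f" for S d f
    by (auto simp: poly2_of_def sum_distrib_right smult_monom simp flip: mult_smult_left
        intro!: sum.cong)
  have rel: "a * f1 + b * f2 + ((\<Sum>p\<in>Z. smult [:cZ p:] (e p)) + smult [:cg:] g) = 0"
    using c(2) finM finite_Z
    by (simp add: sum.Plus mult a_def b_def cZ_def cg_def add.assoc)
  \<comment> \<open>At a point \<open>p\<close> of \<open>Z\<close>, every term of the relation
    except the separator \<open>e p\<close> vanishes.\<close>
  have cZ: "cZ p = 0" if p: "p \<in> Z" for p
  proof -
    have "0 = eval2 (a * f1 + b * f2 + ((\<Sum>p\<in>Z. smult [:cZ p:] (e p)) + smult [:cg:] g)) p"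
      unfolding rel by simp
    also have "\<dots> = (\<Sum>q\<in>Z. cZ q * eval2 (e q) p)"
      using p van by (simp add: eval2_Z)
    also have "\<dots> = (\<Sum>q\<in>{p}. cZ q * eval2 (e q) p)"
      using p e(3)[OF _ p] finite_Z by (intro sum.mono_neutral_right) (auto simp del: split_paired_All)
    finally show ?thesis using e(2)[OF p] by simp
  qed
  then have rel': "a * f1 + b * f2 + smult [:cg:] g = 0" using rel by simp
  \<comment> \<open>Without \<open>g\<close> the relation would be a syzygy of the kind excluded by
    \<open>indep\<close>, making all multipliers zero.\<close>
  have "cg \<noteq> 0"
  proof
    assume "cg = 0"
    then have "a = 0 \<and> b = 0" using indep rel' b_def by simp
    then have "c (Inl s) = 0" if "s \<in> lattice_triangle k" for s
      using that coeff_poly2_of[of "lattice_triangle k" "\<lambda>s. c (Inl s)" "snd s" "fst s"]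
      by (simp add: a_def)
    moreover have "c (Inr (Inl s)) = 0" if "s \<in> M" for s
      using that coeff_poly2_of[OF finM, of "\<lambda>s. c (Inr (Inl s))" "snd s" "fst s"]
        \<open>a = 0 \<and> b = 0\<close> by (simp add: b_def)
    ultimately show False
      using c(1) cZ \<open>cg = 0\<close> by (auto simp: cZ_def cg_def simp del: mem_lattice_triangle)
  qed
  have "smult [:cg:] g = - (a * f1 + b * f2)" using rel' by (simp add: add_eq_0_iff2)
  then have "smult [:- 1 / cg:] (smult [:cg:] g) = smult [:- 1 / cg:] (- (a * f1 + b * f2))"
    by (rule arg_cong)
  then have "- g = smult [:- 1 / cg:] (- (a * f1 + b * f2))"
    using \<open>cg \<noteq> 0\<close> by (simp add: one_pCons[symmetric])
  then have "g = smult [:- 1 / cg:] a * f1 + smult [:- 1 / cg:] b * f2"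
    by (metis minus_minus mult_smult_left smult_add_right smult_minus_right)
  then show thesis
    using that[of "smult [:- 1 / cg:] a" "smult [:- 1 / cg:] b"] M(1) total_degree_smult_le
      total_degree_poly2_of[of _ k] a_def b_def by blast
qed

text \<open>Restricted to a line with four points of \<open>Z\<close>, both cubics would have more
  roots than their degree allows and vanish identically. The whole line would then lie in the finite
  set \<open>Z\<close>.\<close>

lemma card_line_le:
  assumes "(a, b) \<noteq> (0, 0)"
  shows "card {q\<in>Z. b * (fst q - x) - a * (snd q - y) = 0} \<le> 3"
proof (rule ccontr)
  let ?L = "{q\<in>Z. b * (fst q - x) - a * (snd q - y) = 0}"
  assume big: "\<not> ?thesis"
  let ?u = "[:x, a:]" and ?w = "[:y, b:]"
  have ab: "a\<^sup>2 + b\<^sup>2 \<noteq> 0" using assms by (simp add: sum_power2_eq_zero_iff)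
  \<comment> \<open>The parameter of the orthogonal projection of \<open>q\<close> to the line,
    which is \<open>q\<close> itself when \<open>q\<close> lies on it.\<close>
  define t where "t q = (a * (fst q - x) + b * (snd q - y)) / (a\<^sup>2 + b\<^sup>2)" for q
  have t: "x + t q * a = fst q" "y + t q * b = snd q" if "q \<in> ?L" for q
  proof -
    have eq: "b * (fst q - x) = a * (snd q - y)" using that by simp
    have "t q * a * (a\<^sup>2 + b\<^sup>2) = (fst q - x) * (a\<^sup>2 + b\<^sup>2)"
      using ab eq by (simp add: t_def) algebra
    then have "t q * a = fst q - x" using ab mult_right_cancel by blast
    then show "x + t q * a = fst q" by simp
    have "t q * b * (a\<^sup>2 + b\<^sup>2) = (snd q - y) * (a\<^sup>2 + b\<^sup>2)"
      using ab eq by (simp add: t_def) algebra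
    then have "t q * b = snd q - y" using ab mult_right_cancel by blast
    then show "y + t q * b = snd q" by simp
  qed
  have "inj_on t ?L" proof (rule inj_onI)
    fix q r assume "q \<in> ?L" "r \<in> ?L" "t q = t r"
    then show "q = r" using t[of q] t[of r] by (intro prod_eqI) simp_all
  qed
  have *: "subst2 ?u ?w f = 0" if f: "total_degree f = 3" "\<And>q. q \<in> Z \<Longrightarrow> eval2 f q = 0" for f
  proof (rule ccontr)
    assume nz: "subst2 ?u ?w f \<noteq> 0"
    have "t ` ?L \<subseteq> {s. poly (subst2 ?u ?w f) s = 0}"
    proof (rule image_subsetI)
      fix q assume q: "q \<in> ?L"
      then have "eval2 f (x + t q * a, y + t q * b) = 0"
        unfolding t[OF q] using f(2) by simp
      then show "t q \<in> {s. poly (subst2 ?u ?w f) s = 0}" by simp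
    qed
    then have "card ?L \<le> card {s. poly (subst2 ?u ?w f) s = 0}"
      using card_mono[OF poly_roots_finite[OF nz], of "t ` ?L"] card_image[OF \<open>inj_on t ?L\<close>]
      by linarith
    also have "\<dots> \<le> degree (subst2 ?u ?w f)" using nz by (rule card_poly_roots_bound)
    also have "\<dots> \<le> 3" using degree_subst2_le[of ?u ?w f] f by simp
    finally show False using big by simp
  qed
  have "(\<lambda>s. (x + s * a, y + s * b)) ` UNIV \<subseteq> Z"
  proof clarify
    fix s
    have "poly (subst2 ?u ?w f1) s = 0" "poly (subst2 ?u ?w f2) s = 0"
      using * deg1 deg2 eval2_Z by auto
    then show "(x + s * a, y + s * b) \<in> Z" by (simp add: Z_eq)
  qed
  moreover have "inj (\<lambda>s. (x + s * a, y + s * b))" using assms by (auto simp: inj_def)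
  ultimately have "finite (UNIV :: real set)"
    using finite_imageD[OF finite_subset[OF _ finite_Z]] by blast
  then show False using infinite_UNIV_char_0 by blast
qed

lemma pairing_Z:
  assumes "z \<in> Z" "\<And>s. s \<in> Z - {z} \<Longrightarrow> card {t\<in>Z - {z}. f t = f s} \<le> 3"
  obtains p q where "Z - {z} = (\<Union>i<4::nat. {p i, q i})" "\<And>i. i < 4 \<Longrightarrow> f (p i) \<noteq> f (q i)"
proof -
  have "card (Z - {z}) = 2 * 4" using assms(1) card_Z finite_Z by simp
  moreover have "card {t\<in>Z - {z}. f t = f s} \<le> 4" if "s \<in> Z - {z}" for s
    using assms(2)[OF that] by simp
  ultimately obtain p q where
    "Z - {z} = (\<Union>i<4::nat. {p i, q i}) \<and> (\<forall>i<4. f (p i) \<noteq> f (q i))"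
    using pairing[of "Z - {z}" 4 f] finite_Z by blast
  then show thesis using that[of p q] by blast
qed

lemma eval2_joins_eq_0:
  assumes "S = (\<Union>i<n::nat. {p i, q i})" "r \<in> S"
  shows "eval2 (\<Prod>i<n. join (p i) (q i)) r = 0"
proof -
  obtain i where "i < n" "r = p i \<or> r = q i" using assms by auto
  then have "i < n" "eval2 (join (p i) (q i)) r = 0" by (auto simp: eval2_join)
  then show ?thesis unfolding eval2_prod by (intro prod_zero) auto
qed

lemma total_degree_joins: "total_degree (\<Prod>i<n. join (p i) (q i)) \<le> n"
  using total_degree_prod_le[of "{..<n}" "\<lambda>i. join (p i) (q i)"] total_degree_join by auto

text \<open>By \<open>card_line_le\<close> no direction from \<open>z\<close> contains too many of
  the other eight points, so they can be paired with distinct directions; the four joining lines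
  then miss \<open>z\<close>.\<close>

lemma separator:
  assumes z: "z \<in> Z"
  obtains e where "total_degree e \<le> 4" "eval2 e z \<noteq> 0" "\<And>q. q \<in> Z - {z} \<Longrightarrow> eval2 e q = 0"
proof -
  let ?f = "\<lambda>q. (fst q - fst z = 0, (snd q - snd z) / (fst q - fst z))"
  have "card {t\<in>Z - {z}. ?f t = ?f s} \<le> 3" if s: "s \<in> Z - {z}" for s
  proof -
    let ?a = "fst s - fst z" and ?b = "snd s - snd z"
    have "(?a, ?b) \<noteq> (0, 0)" using s by (auto simp: prod_eq_iff)
    then have "card {q\<in>Z. ?b * (fst q - fst z) - ?a * (snd q - snd z) = 0} \<le> 3"
      by (rule card_line_le)
    moreover have "finite {q\<in>Z. ?b * (fst q - fst z) - ?a * (snd q - snd z) = 0}"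
      using finite_Z by simp
    moreover have "{t\<in>Z - {z}. ?f t = ?f s} \<subseteq>
        {q\<in>Z. ?b * (fst q - fst z) - ?a * (snd q - snd z) = 0}"
    proof
      fix t assume t: "t \<in> {t\<in>Z - {z}. ?f t = ?f s}"
      then have "(fst t - fst z, snd t - snd z) \<noteq> (0, 0)" by (auto simp: prod_eq_iff)
      from same_direction_iff[OF this \<open>(?a, ?b) \<noteq> (0, 0)\<close>] t
      show "t \<in> {q\<in>Z. ?b * (fst q - fst z) - ?a * (snd q - snd z) = 0}"
        by (simp add: mult.commute)
    qed
    ultimately show ?thesis by (meson card_mono order_trans)
  qed
  then obtain p q where pq: "Z - {z} = (\<Union>i<4::nat. {p i, q i})" "\<And>i. i < 4 \<Longrightarrow> ?f (p i) \<noteq> ?f (q i)"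
    using pairing_Z[OF z, of ?f] by blast
  let ?e = "\<Prod>i<4. join (p i) (q i)"
  have "eval2 (join (p i) (q i)) z \<noteq> 0" if "i < 4" for i
  proof -
    have "p i \<in> Z - {z}" "q i \<in> Z - {z}" using pq(1) that by blast+
    then have "(fst (p i) - fst z, snd (p i) - snd z) \<noteq> (0, 0)"
      "(fst (q i) - fst z, snd (q i) - snd z) \<noteq> (0, 0)" by (auto simp: prod_eq_iff)
    from same_direction_iff[OF this] show ?thesis
      using pq(2)[OF that] by (simp add: eval2_join)
  qed
  then have "eval2 ?e z \<noteq> 0" by simp
  moreover have "eval2 ?e q = 0" if "q \<in> Z - {z}" for q
    using eval2_joins_eq_0[OF pq(1) that] .
  moreover have "total_degree ?e \<le> 4" by (rule total_degree_joins)
  ultimately show thesis using that by blast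
qed

lemma separator_le:
  assumes "p \<in> Z" "4 \<le> d"
  shows "\<exists>e. total_degree e \<le> d \<and> eval2 e p \<noteq> 0 \<and> (\<forall>q\<in>Z - {p}. eval2 e q = 0)"
proof -
  obtain e where "total_degree e \<le> 4" "eval2 e p \<noteq> 0" "\<And>q. q \<in> Z - {p} \<Longrightarrow> eval2 e q = 0"
    using separator[OF assms(1)] by blast
  with assms(2) show ?thesis by (intro exI[of _ e] conjI ballI) (rule order_trans)
qed

text \<open>The count is 15 < 3 + 3 + 10.\<close>

lemma noether_4:
  assumes "total_degree g \<le> 4" "\<And>p. p \<in> Z \<Longrightarrow> eval2 g p = 0"
  obtains a b where "total_degree a \<le> 1" "total_degree b \<le> 1" "g = a * f1 + b * f2"
proof -
  show thesis
  proof (rule noether_aux[of "lattice_triangle 1" 1 g])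
    fix a c assume rel: "a * f1 + poly2_of (lattice_triangle 1) c * f2 = 0"
    have "total_degree (poly2_of (lattice_triangle 1) c) \<le> 2"
      by (rule total_degree_poly2_of) auto
    then show "a = 0 \<and> poly2_of (lattice_triangle 1) c = 0"
      using syzygy_low_degree[OF rel] by blast
  next
    fix p assume "p \<in> Z"
    then show "\<exists>e. total_degree e \<le> 1 + 3 \<and> eval2 e p \<noteq> 0 \<and> (\<forall>q\<in>Z - {p}. eval2 e q = 0)"
      by (rule separator_le) simp
  next
    show "card (lattice_triangle (1 + 3)) < card (lattice_triangle 1) + card (lattice_triangle 1) + 10"
      by (simp add: card_lattice_triangle)
  qed (use assms that in simp_all)
qed

text \<open>The count is 21 < 6 + 6 + 10.\<close>

lemma noether_5:
  assumes "total_degree g \<le> 5" "\<And>p. p \<in> Z \<Longrightarrow> eval2 g p = 0"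
  obtains a b where "total_degree a \<le> 2" "total_degree b \<le> 2" "g = a * f1 + b * f2"
proof -
  show thesis
  proof (rule noether_aux[of "lattice_triangle 2" 2 g])
    fix a c assume rel: "a * f1 + poly2_of (lattice_triangle 2) c * f2 = 0"
    have "total_degree (poly2_of (lattice_triangle 2) c) \<le> 2"
      by (rule total_degree_poly2_of) auto
    then show "a = 0 \<and> poly2_of (lattice_triangle 2) c = 0"
      using syzygy_low_degree[OF rel] by blast
  next
    fix p assume "p \<in> Z"
    then show "\<exists>e. total_degree e \<le> 2 + 3 \<and> eval2 e p \<noteq> 0 \<and> (\<forall>q\<in>Z - {p}. eval2 e q = 0)"
      by (rule separator_le) simp
  next
    show "card (lattice_triangle (2 + 3)) < card (lattice_triangle 2) + card (lattice_triangle 2) + 10"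
      by (simp add: card_lattice_triangle)
  qed (use assms that in simp_all)
qed

text \<open>The count is 28 < 10 + 9 + 10, with one monomial given up because multipliers of degree
  3 admit the Koszul relation.\<close>

lemma noether_6:
  assumes "total_degree g \<le> 6" "\<And>p. p \<in> Z \<Longrightarrow> eval2 g p = 0"
  obtains a b where "total_degree a \<le> 3" "total_degree b \<le> 3" "g = a * f1 + b * f2"
proof -
  have "\<not> total_degree f1 \<le> 2" using deg1 by simp
  then obtain i j where ij: "coeff (coeff f1 j) i \<noteq> 0" by (auto simp: total_degree_le_iff)
  then have mem: "(i, j) \<in> lattice_triangle 3"
    using deg1 total_degree_le_iff[of f1 3] by (auto simp: not_le[symmetric])
  \<comment> \<open>The omitted monomial occurs in \<open>f1\<close>, so a multiple
    \<open>t f1\<close> supported on \<open>?M\<close> forces \<open>t = 0\<close>.\<close>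
  let ?M = "lattice_triangle 3 - {(i, j)}"
  show thesis
  proof (rule noether_aux[of ?M 3 g])
    fix a c assume rel: "a * f1 + poly2_of ?M c * f2 = 0"
    have "total_degree (poly2_of ?M c) \<le> 3" by (rule total_degree_poly2_of) auto
    with rel obtain t where t: "a = smult [:- t:] f2" "poly2_of ?M c = smult [:t:] f1"
      by (rule syzygy)
    have "coeff (coeff (poly2_of ?M c) j) i = 0" by (simp add: coeff_poly2_of)
    then have "t = 0" using ij t(2) by simp
    then show "a = 0 \<and> poly2_of ?M c = 0" using t by simp
  next
    fix p assume "p \<in> Z"
    then show "\<exists>e. total_degree e \<le> 3 + 3 \<and> eval2 e p \<noteq> 0 \<and> (\<forall>q\<in>Z - {p}. eval2 e q = 0)"
      by (rule separator_le) simp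
  next
    show "card (lattice_triangle (3 + 3)) < card (lattice_triangle 3) + card ?M + 10"
      using mem by (simp add: card_lattice_triangle)
  qed (use assms that in auto)
qed

section \<open>Transversality and behaviour at infinity\<close>

lemma gradients_span:
  assumes z: "z \<in> Z"
  obtains s t where "gradient (smult [:s:] f1 + smult [:t:] f2) z = v"
proof -
  obtain e where e: "total_degree e \<le> 4" "eval2 e z \<noteq> 0" "\<And>q. q \<in> Z - {z} \<Longrightarrow> eval2 e q = 0"
    using separator[OF z] by blast
  \<comment> \<open>A linear polynomial that vanishes at \<open>z\<close> and has gradient
    \<open>v\<close>. Thus \<open>e * ?l\<close> vanishes on \<open>Z\<close> and has gradient
    \<open>e(z) v\<close> at \<open>z\<close>, while its expression through \<open>f1\<close> and
    \<open>f2\<close> has a combination of their gradients there.\<close>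
  let ?l = "lin (fst v) (snd v) (- fst v * fst z - snd v * snd z)"
  have "total_degree (e * ?l) \<le> 5"
    using total_degree_mult_le[OF e(1) total_degree_lin] by simp
  moreover have "eval2 (e * ?l) q = 0" if "q \<in> Z" for q
    using e(3)[of q] that by (cases "q = z") simp_all
  ultimately obtain a b where ab: "e * ?l = a * f1 + b * f2" by (rule noether_5)
  have "eval2 e z *\<^sub>R v = gradient (e * ?l) z"
    by (simp add: gradient_mult gradient_lin)
  also have "\<dots> = eval2 a z *\<^sub>R gradient f1 z + eval2 b z *\<^sub>R gradient f2 z"
    unfolding ab using z by (simp add: gradient_add gradient_mult eval2_Z)
  finally have "(1 / eval2 e z) *\<^sub>R eval2 e z *\<^sub>R v =
      (1 / eval2 e z) *\<^sub>R (eval2 a z *\<^sub>R gradient f1 z + eval2 b z *\<^sub>R gradient f2 z)" by simp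
  then have "v = gradient (smult [:eval2 a z / eval2 e z:] f1 + smult [:eval2 b z / eval2 e z:] f2) z"
    using e(2) by (simp add: gradient_add gradient_smult scaleR_add_right)
  then show thesis using that by metis
qed

lemma gradients_independent:
  assumes z: "z \<in> Z"
  shows "fst (gradient f1 z) * snd (gradient f2 z) - fst (gradient f2 z) * snd (gradient f1 z) \<noteq> 0"
proof -
  obtain x1 y1 x2 y2 where grad: "gradient f1 z = (x1, y1)" "gradient f2 z = (x2, y2)"
    by fastforce
  obtain s t where "gradient (smult [:s:] f1 + smult [:t:] f2) z = (1, 0)"
    using gradients_span[OF z] by blast
  then have "s * x1 + t * x2 = 1" "s * y1 + t * y2 = 0"
    by (simp_all add: gradient_add gradient_smult grad)
  moreover obtain s' t' where "gradient (smult [:s':] f1 + smult [:t':] f2) z = (0, 1)"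
    using gradients_span[OF z] by blast
  then have "s' * x1 + t' * x2 = 0" "s' * y1 + t' * y2 = 1"
    by (simp_all add: gradient_add gradient_smult grad)
  ultimately have "x1 * y2 - x2 * y1 \<noteq> 0" by algebra
  then show ?thesis by (simp add: grad)
qed

text \<open>At a common zero \<open>(a, b)\<close> of the cubic forms, every quintic vanishing on
  \<open>Z\<close> would have zero degree 5 part by \<open>noether_5\<close>. Five lines covering
  \<open>Z\<close>, none with direction \<open>(a, b)\<close>, give a counterexample.\<close>

lemma form_3_nonzero:
  assumes ab: "(a, b) \<noteq> (0, 0)"
  shows "form 3 f1 a b \<noteq> 0 \<or> form 3 f2 a b \<noteq> 0"
proof (rule ccontr)
  assume "\<not> ?thesis"
  then have zero: "form 3 f1 a b = 0" "form 3 f2 a b = 0" by auto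
  have "Z \<noteq> {}" using card_Z by auto
  then obtain z where z: "z \<in> Z" by blast
  \<comment> \<open>Constant exactly along lines of direction \<open>(a, b)\<close>, so partners
    with distinct values have a join that is not parallel to \<open>(a, b)\<close>.\<close>
  let ?f = "\<lambda>q. b * fst q - a * snd q"
  have "card {t\<in>Z - {z}. ?f t = ?f s} \<le> 3" if "s \<in> Z - {z}" for s
  proof -
    have "{t\<in>Z - {z}. ?f t = ?f s} \<subseteq> {q\<in>Z. b * (fst q - fst s) - a * (snd q - snd s) = 0}"
    proof
      fix t assume "t \<in> {t\<in>Z - {z}. ?f t = ?f s}"
      then show "t \<in> {q\<in>Z. b * (fst q - fst s) - a * (snd q - snd s) = 0}"
        by (simp add: right_diff_distrib)
    qed
    moreover have "finite {q\<in>Z. b * (fst q - fst s) - a * (snd q - snd s) = 0}"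
      using finite_Z by simp
    ultimately show ?thesis using card_line_le[OF ab, of "fst s" "snd s"]
      by (meson card_mono order_trans)
  qed
  then obtain p q where pq: "Z - {z} = (\<Union>i<4::nat. {p i, q i})" "\<And>i. i < 4 \<Longrightarrow> ?f (p i) \<noteq> ?f (q i)"
    using pairing_Z[OF z, of ?f] by blast
  let ?e = "\<Prod>i<4. join (p i) (q i)"
  \<comment> \<open>The fifth line passes through \<open>z\<close> with normal
    \<open>(a, b)\<close>; its form at \<open>(a, b)\<close> is \<open>a^2 + b^2\<close>.\<close>
  let ?l = "lin a b (- a * fst z - b * snd z)"
  have dege: "total_degree ?e \<le> 4" by (rule total_degree_joins)
  have "total_degree (?e * ?l) \<le> 5"
    using total_degree_mult_le[OF dege total_degree_lin] by simp
  moreover have "eval2 (?e * ?l) r = 0" if "r \<in> Z" for r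
    using eval2_joins_eq_0[OF pq(1), of r] that by (cases "r = z") (simp_all del: eval2_prod)
  ultimately obtain g h where gh: "total_degree g \<le> 2" "total_degree h \<le> 2" "?e * ?l = g * f1 + h * f2"
    by (rule noether_5)
  have "form (2 + 3) (g * f1 + h * f2) a b = 0"
    using form_mult[OF gh(1), of f1 3 a b] form_mult[OF gh(2), of f2 3 a b] zero deg1 deg2
    by simp
  moreover have "form (4 + 1) (?e * ?l) a b = form 4 ?e a b * form 1 ?l a b"
    by (rule form_mult[OF dege total_degree_lin])
  moreover have "form 4 ?e a b = (\<Prod>i<4. form 1 (join (p i) (q i)) a b)"
    using form_prod[of "{..<4::nat}" "\<lambda>i. join (p i) (q i)" a b] total_degree_join by simp
  moreover have "form 1 (join (p i) (q i)) a b \<noteq> 0" if "i < 4" for i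
    using pq(2)[OF that] by (simp add: algebra_simps)
  moreover have "form 1 ?l a b \<noteq> 0"
    using ab by (auto simp: sum_power2_eq_zero_iff simp flip: power2_eq_square)
  ultimately show False using gh(3) by simp
qed

section \<open>Cubics through eight of the points\<close>

lemma linear_cofactor:
  assumes "lin 0 1 (- y) * l = lin 1 0 (- x) * m" "total_degree l \<le> 1"
  obtains s where "l = smult [:s:] (lin 1 0 (- x))"
proof -
  obtain \<alpha> \<beta> \<gamma> where l: "l = lin \<alpha> \<beta> \<gamma>" using assms(2) by (rule total_degree_le_1E)
  \<comment> \<open>On the vertical line through \<open>x\<close> the right side vanishes, hence so
    does \<open>l\<close> wherever the factor \<open>s\<close> is nonzero. Two such points determine
    \<open>l\<close> on that line.\<close>
  have "(\<alpha> * x + \<beta> * (y + s) + \<gamma>) * s = 0" for s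
    using arg_cong[OF assms(1), of "\<lambda>p. eval2 p (x, y + s)"] by (simp add: l mult.commute)
  from this[of 1] this[of 2]
  have eqs: "\<alpha> * x + \<beta> * y + \<beta> + \<gamma> = 0" "\<alpha> * x + \<beta> * y + 2 * \<beta> + \<gamma> = 0"
    by (simp_all add: distrib_left mult.commute)
  then have "\<beta> = 0" by linarith
  then have "\<gamma> = - \<alpha> * x" using eqs(1) by (simp add: add_eq_0_iff)
  with \<open>\<beta> = 0\<close> have "l = smult [:\<alpha>:] (lin 1 0 (- x))" by (simp add: l lin_def)
  then show thesis by (rule that)
qed

text \<open>The Cayley-Bacharach argument. \<open>?X * h\<close> and \<open>?Y * h\<close> vanish on
  all of \<open>Z\<close>, so both have linear cofactors; equating \<open>?Y * (?X * h)\<close> with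
  \<open>?X * (?Y * h)\<close> leaves no syzygy of such low degree. The cofactors of
  \<open>?X * h\<close> are thus constant multiples of \<open>?X\<close>, which cancels.\<close>

lemma cubic_in_span:
  assumes w: "w \<in> Z" and h: "total_degree h \<le> 3" "\<And>p. p \<in> Z - {w} \<Longrightarrow> eval2 h p = 0"
  obtains s t where "h = smult [:s:] f1 + smult [:t:] f2"
proof -
  let ?X = "lin 1 0 (- fst w)" and ?Y = "lin 0 1 (- snd w)"
  have "total_degree (?X * h) \<le> 4" "total_degree (?Y * h) \<le> 4"
    using total_degree_mult_le[OF total_degree_lin h(1)] by simp_all
  moreover have "eval2 (?X * h) p = 0" "eval2 (?Y * h) p = 0" if "p \<in> Z" for p
    using h(2)[of p] that by (cases "p = w"; simp)+
  ultimately obtain l1 l2 m1 m2 where l: "total_degree l1 \<le> 1" "total_degree l2 \<le> 1"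
      "?X * h = l1 * f1 + l2 * f2"
    and m: "total_degree m1 \<le> 1" "total_degree m2 \<le> 1" "?Y * h = m1 * f1 + m2 * f2"
    using noether_4[of "?X * h"] noether_4[of "?Y * h"] by metis
  have "?Y * (l1 * f1 + l2 * f2) = ?X * (m1 * f1 + m2 * f2)"
    unfolding l(3)[symmetric] m(3)[symmetric] by (simp add: mult.left_commute)
  then have rel: "(?Y * l1 - ?X * m1) * f1 + (?Y * l2 - ?X * m2) * f2 = 0"
    by (simp add: algebra_simps)
  have "total_degree (?Y * l2 - ?X * m2) \<le> 2"
    using total_degree_mult_le[OF total_degree_lin l(2)] total_degree_mult_le[OF total_degree_lin m(2)]
    by (intro total_degree_diff_le) (simp_all add: numeral_2_eq_2)
  from syzygy_low_degree[OF rel this] have "?Y * l1 = ?X * m1" "?Y * l2 = ?X * m2" by auto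
  then obtain s t where "l1 = smult [:s:] ?X" "l2 = smult [:t:] ?X"
    using linear_cofactor l by metis
  then have "?X * h = ?X * (smult [:s:] f1 + smult [:t:] f2)"
    using l(3) by (simp add: algebra_simps)
  moreover have "?X \<noteq> 0" by (simp add: lin_def)
  ultimately have "h = smult [:s:] f1 + smult [:t:] f2" using mult_left_cancel by blast
  then show thesis by (rule that)
qed

section \<open>Sextics singular at eight of the points\<close>

lemma independent:
  assumes "smult [:s:] f1 + smult [:t:] f2 = 0"
  shows "s = 0" "t = 0"
proof -
  have "[:[:s:]:] * f1 + [:[:t:]:] * f2 = 0" using assms by simp
  moreover have "total_degree [:[:t:]:] \<le> 2"
    by (auto simp: total_degree_le_iff coeff_pCons split: nat.splits)
  ultimately show "s = 0" "t = 0" using syzygy_low_degree by (metis pCons_eq_0_iff)+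
qed

text \<open>Provides points where the vectors of values of \<open>f1\<close> and \<open>f2\<close>
  are pairwise independent, so that vanishing at all three rules out nonzero quadratic forms in
  \<open>f1\<close> and \<open>f2\<close>.\<close>

lemma three_directions:
  obtains q1 q2 q3 where
    "eval2 f1 q1 * eval2 f2 q2 \<noteq> eval2 f2 q1 * eval2 f1 q2"
    "eval2 f1 q1 * eval2 f2 q3 \<noteq> eval2 f2 q1 * eval2 f1 q3"
    "eval2 f1 q2 * eval2 f2 q3 \<noteq> eval2 f2 q2 * eval2 f1 q3"
proof -
  have ex: "\<exists>a. eval2 p a \<noteq> 0" if "p \<noteq> 0" for p
    using that eval2_eqI[of p 0] by auto
  \<comment> \<open>A member of the pencil that vanishes at \<open>q\<close>. Choosing
    \<open>q2\<close> off \<open>k q1\<close> and \<open>q3\<close> off both \<open>k q1\<close> and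
    \<open>k q2\<close> gives the three inequalities.\<close>
  define k where "k q = smult [:- eval2 f2 q:] f1 + smult [:eval2 f1 q:] f2" for q
  have k: "eval2 (k q) r = eval2 f1 q * eval2 f2 r - eval2 f2 q * eval2 f1 r" for q r
    by (simp add: k_def)
  obtain q1 where q1: "eval2 f1 q1 \<noteq> 0" using ex nonzero by blast
  then have k1: "k q1 \<noteq> 0" unfolding k_def using independent(2) by blast
  then obtain q2 where q2: "eval2 (k q1) q2 \<noteq> 0" using ex by blast
  then have "eval2 f1 q2 \<noteq> 0 \<or> - eval2 f2 q2 \<noteq> 0" by (auto simp: k)
  then have "k q2 \<noteq> 0" unfolding k_def using independent by blast
  with k1 obtain q3 where "eval2 (k q1 * k q2) q3 \<noteq> 0" using ex[of "k q1 * k q2"] by auto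
  then show thesis using that[of q1 q2 q3] q2 by (auto simp: k)
qed

text \<open>
  The 24 conditions of being singular at eight points together with three further vanishing
  conditions leave a nonzero sextic, since sextics form a space of dimension 28; the three
  conditions exclude the quadratic forms in \<open>f1\<close> and \<open>f2\<close>.
\<close>

lemma singular_sextic:
  assumes w: "w \<in> Z"
  obtains g where "total_degree g \<le> 6" "\<And>p. p \<in> Z - {w} \<Longrightarrow> eval2 g p = 0 \<and> gradient g p = 0"
    "eval2 g w > 0"
proof -
  obtain q1 q2 q3 where q:
    "eval2 f1 q1 * eval2 f2 q2 \<noteq> eval2 f2 q1 * eval2 f1 q2"
    "eval2 f1 q1 * eval2 f2 q3 \<noteq> eval2 f2 q1 * eval2 f1 q3"
    "eval2 f1 q2 * eval2 f2 q3 \<noteq> eval2 f2 q2 * eval2 f1 q3"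
    by (rule three_directions)
  \<comment> \<open>The tag selects the condition: 0 for the value, 1 and 2 for the partial
    derivatives. At most 24 + 3 conditions are imposed.\<close>
  define K where "K = (Z - {w}) \<times> {0, 1, 2::nat} \<union> {(q1, 0), (q2, 0), (q3, 0)}"
  define \<phi> where "\<phi> k g = (if snd k = 1 then eval2 (partial_x g) (fst k)
      else if snd k = 2 then eval2 (partial_y g) (fst k) else eval2 g (fst k))"
    for k :: "(real \<times> real) \<times> nat" and g
  have "finite K" using finite_Z by (simp add: K_def)
  moreover have "card K < card (lattice_triangle 6)"
  proof -
    have "card K \<le> card ((Z - {w}) \<times> {0, 1, 2::nat}) + card {(q1, 0::nat), (q2, 0), (q3, 0)}"
      unfolding K_def by (rule card_Un_le)
    also have "card ((Z - {w}) \<times> {0, 1, 2::nat}) = 24"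
      using w finite_Z card_Z by (simp add: card_cartesian_product)
    also have "card {(q1, 0::nat), (q2, 0), (q3, 0)} \<le> 3"
      using card_length[of "[(q1, 0::nat), (q2, 0), (q3, 0)]"] by simp
    finally show ?thesis by (simp add: card_lattice_triangle)
  qed
  ultimately obtain g where g: "g \<noteq> 0" "total_degree g \<le> 6" "\<And>k. k \<in> K \<Longrightarrow> \<phi> k g = 0"
    by (rule common_kernel[where \<phi> = \<phi>]) (auto simp: \<phi>_def)
  have sing: "eval2 g p = 0" "gradient g p = 0" if "p \<in> Z - {w}" for p
    using g(3)[of "(p, 0)"] g(3)[of "(p, 1)"] g(3)[of "(p, 2)"] that
    by (auto simp: K_def \<phi>_def gradient_def zero_prod_def)
  have q0: "eval2 g q1 = 0" "eval2 g q2 = 0" "eval2 g q3 = 0"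
    using g(3)[of "(q1, 0)"] g(3)[of "(q2, 0)"] g(3)[of "(q3, 0)"] by (auto simp: K_def \<phi>_def)
  have "eval2 g w \<noteq> 0"
  proof
    assume "eval2 g w = 0"
    then have "eval2 g p = 0" if "p \<in> Z" for p using sing(1)[of p] that by (cases "p = w") auto
    with g(2) obtain a b where ab: "total_degree a \<le> 3" "total_degree b \<le> 3" "g = a * f1 + b * f2"
      by (rule noether_6)
    \<comment> \<open>At a zero of both cubics the gradient of \<open>a * f1 + b * f2\<close> is the
      combination of their gradients with coefficients \<open>a(p)\<close> and \<open>b(p)\<close>;
      transversality forces both to vanish.\<close>
    have van: "eval2 a p = 0 \<and> eval2 b p = 0" if p: "p \<in> Z - {w}" for p
    proof -
      let ?a = "eval2 a p" and ?b = "eval2 b p"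
      have rel: "?a *\<^sub>R gradient f1 p + ?b *\<^sub>R gradient f2 p = 0"
        using sing(2)[OF p] p unfolding ab by (simp add: gradient_add gradient_mult eval2_Z)
      obtain x1 y1 x2 y2 where grad: "gradient f1 p = (x1, y1)" "gradient f2 p = (x2, y2)"
        by fastforce
      have r: "?a * x1 + ?b * x2 = 0" "?a * y1 + ?b * y2 = 0"
        using rel by (auto simp: grad zero_prod_def)
      have "x1 * y2 - x2 * y1 \<noteq> 0" using gradients_independent[of p] p by (simp add: grad)
      moreover have "?a * (x1 * y2 - x2 * y1) = 0" "?b * (x1 * y2 - x2 * y1) = 0"
        using r by algebra+
      ultimately show ?thesis by simp
    qed
    obtain s t where a: "a = smult [:s:] f1 + smult [:t:] f2"
      using cubic_in_span[OF w ab(1)] van by blast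
    obtain s' t' where b: "b = smult [:s':] f1 + smult [:t':] f2"
      using cubic_in_span[OF w ab(2)] van by blast
    have g_eq: "eval2 g r =
        s * (eval2 f1 r)\<^sup>2 + (t + s') * (eval2 f1 r * eval2 f2 r) + t' * (eval2 f2 r)\<^sup>2" for r
      unfolding ab a b by (simp add: power2_eq_square algebra_simps)
    have "s = 0" "t + s' = 0" "t' = 0"
      using binary_quadratic_eq_0[OF _ _ _ q] q0 unfolding g_eq by blast+
    then have "g = 0" by (intro eval2_eqI) (simp add: g_eq)
    then show False using g(1) by simp
  qed
  \<comment> \<open>All conditions at the eight points are linear, so the sign of \<open>g\<close>
    may be switched.\<close>
  then consider "eval2 g w > 0" | "eval2 (- g) w > 0" by fastforce
  then show thesis
  proof cases
    case 1
    then show ?thesis using that[of g] g(2) sing by blast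
  next
    case 2
    have "gradient (- g) p = - gradient g p" for p
      using gradient_smult[of "- 1" g p] by (simp add: one_pCons[symmetric])
    moreover have "total_degree (- g) \<le> 6"
      using g(2) by (simp add: total_degree_le_iff)
    ultimately show ?thesis using 2 that[of "- g"] sing by simp
  qed
qed

section \<open>The cubics through eight points and a bound for sextics\<close>

lemma I1_eq_span:
  assumes "w \<in> Z"
  shows "I1 3 (Z - {w}) = {smult [:s:] f1 + smult [:t:] f2 | s t. True}"
proof (intro equalityI subsetI)
  fix h assume "h \<in> I1 3 (Z - {w})"
  then have "total_degree h \<le> 3" "\<And>p. p \<in> Z - {w} \<Longrightarrow> eval2 h p = 0"
    by (simp_all add: I1_def)
  with assms obtain s t where "h = smult [:s:] f1 + smult [:t:] f2" by (rule cubic_in_span)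
  then show "h \<in> {smult [:s:] f1 + smult [:t:] f2 | s t. True}" by blast
next
  fix h assume "h \<in> {smult [:s:] f1 + smult [:t:] f2 | s t. True}"
  then show "h \<in> I1 3 (Z - {w})"
    using deg1 deg2 by (auto simp: I1_def eval2_Z intro!: total_degree_add_le total_degree_smult_le)
qed

lemma eval2_I1:
  assumes "h \<in> I1 3 (Z - {w})" "w \<in> Z" "p \<in> Z"
  shows "eval2 h p = 0"
proof -
  obtain s t where "h = smult [:s:] f1 + smult [:t:] f2"
    using assms I1_eq_span by blast
  then show ?thesis using assms(3) by (simp add: eval2_Z)
qed

lemma basis_f1_f2:
  assumes "w \<in> Z"
  shows "f1 \<in> I1 3 (Z - {w})" "f2 \<in> I1 3 (Z - {w})"
  using deg1 deg2 by (auto simp: I1_def eval2_Z)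

lemma tilde_eq:
  assumes w: "w \<in> Z"
  shows "tilde 3 (Z - {w}) = {w}"
proof -
  have "{p. \<forall>h\<in>I1 3 (Z - {w}). eval2 h p = 0} = Z"
    using basis_f1_f2[OF w] eval2_I1[OF _ w] unfolding Z_eq by blast
  then show ?thesis using w by (auto simp: tilde_def)
qed

lemma full: "w \<in> Z \<Longrightarrow> full 3 (Z - {w})"
  unfolding full_def
proof (intro ballI allI)
  fix p v assume "w \<in> Z" "p \<in> Z - {w}"
  then obtain s t where "gradient (smult [:s:] f1 + smult [:t:] f2) p = v"
    using gradients_span[of p v] by blast
  then show "\<exists>h\<in>I1 3 (Z - {w}). gradient h p = v"
    using \<open>w \<in> Z\<close> by (auto simp: I1_eq_span)
qed

text \<open>Applied later to the negative of the sextic from \<open>singular_sextic\<close>.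
  Locally, transversality handles the eight points, the sign of \<open>g\<close> handles
  \<open>w\<close>, and positivity of \<open>f1^2 + f2^2\<close> handles all other points;
  \<open>form_3_nonzero\<close> handles infinity.\<close>

lemma sextic_dominated:
  assumes w: "w \<in> Z" and g: "total_degree g \<le> 6"
    "\<And>p. p \<in> Z - {w} \<Longrightarrow> eval2 g p = 0 \<and> gradient g p = 0" "eval2 g w < 0"
  shows "\<exists>C\<ge>0. \<forall>a. eval2 g a \<le> C * eval2 (f1\<^sup>2 + f2\<^sup>2) a"
proof (rule global_domination[of _ 6])
  have sq: "total_degree (f\<^sup>2) \<le> 6" "form 6 (f\<^sup>2) a b = (form 3 f a b)\<^sup>2"
    if "total_degree f = 3" for f a b
    using total_degree_mult_le[of f 3 f 3] form_mult[of f 3 f 3 a b] that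
    by (simp_all add: power2_eq_square)
  show "total_degree (f1\<^sup>2 + f2\<^sup>2) \<le> 6"
    using sq deg1 deg2 by (intro total_degree_add_le)
  show "form 6 (f1\<^sup>2 + f2\<^sup>2) a b > 0" if "(a, b) \<noteq> (0, 0)" for a b
    using form_3_nonzero[OF that] sq(2) deg1 deg2 by (simp add: sum_power2_gt_zero_iff)
  show "\<exists>C\<ge>0. \<forall>\<^sub>F a in nhds p. eval2 g a \<le> C * eval2 (f1\<^sup>2 + f2\<^sup>2) a" for p
  proof -
    have cont: "continuous_on UNIV (eval2 f)" for f
      using continuous_eval2[OF continuous_on_id, of UNIV f] by simp
    consider "p \<in> Z - {w}" | "p = w" | "p \<notin> Z" by blast
    then show ?thesis
    proof cases
      case 1
      then show ?thesis
        using g(2) gradients_independent by (intro domination_at_node) (auto simp: eval2_Z)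
    next
      case 2
      then have "\<forall>\<^sub>F a in nhds p. eval2 g a < 0"
        using order_tendstoD(2)[OF tendsto_nhds_continuous[OF cont]] g(3) by blast
      then have "\<forall>\<^sub>F a in nhds p. eval2 g a \<le> 0 * eval2 (f1\<^sup>2 + f2\<^sup>2) a"
        by eventually_elim simp
      then show ?thesis by blast
    next
      case 3
      then have "eval2 (f1\<^sup>2 + f2\<^sup>2) p > 0" by (auto simp: Z_eq sum_power2_gt_zero_iff)
      then show ?thesis
        by (rule local_domination[OF cont[of "f1\<^sup>2 + f2\<^sup>2"] cont[of g]])
          (simp_all add: mult.commute)
    qed
  qed
qed (use g in simp_all)

section \<open>The sum of squares of an arbitrary basis and its perturbation\<close>

context
  fixes w H
  assumes w: "w \<in> Z" and basis: "is_basis H (I1 3 (Z - {w}))"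
begin

lemma finite_basis: "finite H"
  using basis by (simp add: is_basis_def)

lemma basis_subset: "h \<in> H \<Longrightarrow> h \<in> I1 3 (Z - {w})"
  using basis by (auto simp: is_basis_def)

lemma basis_combination:
  assumes "f \<in> I1 3 (Z - {w})"
  obtains c where "f = (\<Sum>h\<in>H. smult [:c h:] h)"
proof -
  have "f \<in> poly2.span H" using assms basis by (auto simp: is_basis_def)
  then show thesis using that by (auto simp: poly2.span_finite[OF finite_basis])
qed

lemma total_degree_basis_squares: "total_degree (\<Sum>h\<in>H. h\<^sup>2) \<le> 6"
proof (rule total_degree_sum_le)
  fix h assume "h \<in> H"
  then have "total_degree h \<le> 3" using basis_subset by (simp add: I1_def)
  then show "total_degree (h\<^sup>2) \<le> 6"
    using total_degree_mult_le[of h 3 h 3] by (simp add: power2_eq_square)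
qed

lemma form_basis_squares: "form 6 (\<Sum>h\<in>H. h\<^sup>2) a b = (\<Sum>h\<in>H. (form 3 h a b)\<^sup>2)"
  unfolding form_sum
proof (rule sum.cong)
  fix h assume "h \<in> H"
  then have "total_degree h \<le> 3" using basis_subset by (simp add: I1_def)
  then show "form 6 (h\<^sup>2) a b = (form 3 h a b)\<^sup>2"
    using form_mult[of h 3 h 3 a b] by (simp add: power2_eq_square)
qed simp

text \<open>A zero of the sum of squared forms is a common zero of the cubic forms of the basis,
  hence of those of \<open>f1\<close> and \<open>f2\<close>.\<close>

lemma form_basis_squares_nonzero:
  assumes ab: "(a, b) \<noteq> (0, 0)"
  shows "form 6 (\<Sum>h\<in>H. h\<^sup>2) a b \<noteq> 0"
proof
  assume "form 6 (\<Sum>h\<in>H. h\<^sup>2) a b = 0"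
  then have 0: "form 3 h a b = 0" if "h \<in> H" for h
    using that finite_basis by (simp add: form_basis_squares sum_nonneg_eq_0_iff)
  have "form 3 f a b = 0" if "f \<in> I1 3 (Z - {w})" for f
  proof -
    obtain c where "f = (\<Sum>h\<in>H. smult [:c h:] h)" using \<open>f \<in> _\<close> by (rule basis_combination)
    then show ?thesis using 0 by (simp add: form_sum)
  qed
  then show False using form_3_nonzero[OF ab] basis_f1_f2[OF w] by blast
qed

lemma no_zero_at_infinity: "\<not> zero_at_infinity (\<Sum>h\<in>H. h\<^sup>2)"
proof -
  let ?F = "\<Sum>h\<in>H. h\<^sup>2"
  \<comment> \<open>\<open>zero_at_infinity\<close> homogenizes to the actual total degree, so this
    must be shown to be exactly 6.\<close>
  have "\<not> total_degree ?F \<le> 5"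
  proof
    assume "total_degree ?F \<le> 5"
    then have "form 6 ?F 1 0 = 0" by (simp add: form_def total_degree_le_iff)
    then show False using form_basis_squares_nonzero[of 1 0] by simp
  qed
  then have "total_degree ?F = 6" using total_degree_basis_squares by simp
  then show ?thesis
    using form_basis_squares_nonzero by (auto simp: zero_at_infinity_def homogenization_infinity)
qed

text \<open>Cauchy-Schwarz applied to the expansions of \<open>f1\<close> and \<open>f2\<close> in
  the basis; it carries the bound of \<open>sextic_dominated\<close> over to an arbitrary
  basis.\<close>

lemma squares_le_basis_squares:
  "\<exists>K\<ge>0. \<forall>a. eval2 (f1\<^sup>2 + f2\<^sup>2) a \<le> K * eval2 (\<Sum>h\<in>H. h\<^sup>2) a"
proof -
  have bound: "\<exists>K\<ge>0. \<forall>a. eval2 (f\<^sup>2) a \<le> K * eval2 (\<Sum>h\<in>H. h\<^sup>2) a"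
    if "f \<in> I1 3 (Z - {w})" for f
  proof -
    obtain c where f: "f = (\<Sum>h\<in>H. smult [:c h:] h)" using \<open>f \<in> _\<close> by (rule basis_combination)
    have "eval2 (f\<^sup>2) a \<le> (\<Sum>h\<in>H. (c h)\<^sup>2) * eval2 (\<Sum>h\<in>H. h\<^sup>2) a" for a
      using Cauchy_Schwarz_ineq_sum[of c "\<lambda>h. eval2 h a" H] by (simp add: f)
    then show ?thesis by (intro exI[of _ "\<Sum>h\<in>H. (c h)\<^sup>2"]) (simp add: sum_nonneg)
  qed
  obtain K1 K2 where "K1 \<ge> 0" "K2 \<ge> 0"
    "\<And>a. eval2 (f1\<^sup>2) a \<le> K1 * eval2 (\<Sum>h\<in>H. h\<^sup>2) a"
    "\<And>a. eval2 (f2\<^sup>2) a \<le> K2 * eval2 (\<Sum>h\<in>H. h\<^sup>2) a"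
    using bound[OF basis_f1_f2(1)[OF w]] bound[OF basis_f1_f2(2)[OF w]] by blast
  then show ?thesis
    by (intro exI[of _ "K1 + K2"]) (simp add: distrib_right add_mono del: eval2_power eval2_sum)
qed

lemma eval2_basis_squares_Z:
  assumes "p \<in> Z"
  shows "eval2 (\<Sum>h\<in>H. h\<^sup>2) p = 0"
  using basis_subset eval2_I1[OF _ w assms] by (auto intro!: sum.neutral)

lemma hilbert_perturbation:
  "\<exists>g\<in>I2 6 (Z - {w}) - I1_squared 3 (Z - {w}). eval2 g w > 0 \<and>
     (\<exists>c>0. psd ((\<Sum>h\<in>H. h\<^sup>2) + smult [:c:] g) \<and> \<not> sos ((\<Sum>h\<in>H. h\<^sup>2) + smult [:c:] g))"
proof -
  let ?F = "\<Sum>h\<in>H. h\<^sup>2"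
  obtain g where g: "total_degree g \<le> 6" "\<And>p. p \<in> Z - {w} \<Longrightarrow> eval2 g p = 0 \<and> gradient g p = 0"
    "eval2 g w > 0" using singular_sextic[OF w] by blast
  have "g \<in> I2 6 (Z - {w})"
    using g by (simp add: I2_def gradient_def zero_prod_def)
  moreover have "g \<notin> I1_squared 3 (Z - {w})"
  proof
    assume "g \<in> I1_squared 3 (Z - {w})"
    then have "eval2 g w = 0"
      using eval2_I1[OF _ w w] by (auto simp: I1_squared_def)
    then show False using g(3) by simp
  qed
  moreover have "\<exists>c>0. psd (?F + smult [:c:] g) \<and> \<not> sos (?F + smult [:c:] g)"
  proof -
    have neg: "- g = smult [:- 1:] g" by (simp add: one_pCons[symmetric])
    have "gradient (- g) p = 0" if "p \<in> Z - {w}" for p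
      unfolding neg using g(2)[OF that] by (simp only: gradient_smult) simp
    then obtain C where C: "C \<ge> 0" "\<And>a. - eval2 g a \<le> C * eval2 (f1\<^sup>2 + f2\<^sup>2) a"
      using sextic_dominated[OF w, of "- g"] g total_degree_smult_le[OF g(1), of "- 1"]
      by (auto simp: neg[symmetric])
    obtain K where K: "K \<ge> 0" "\<And>a. eval2 (f1\<^sup>2 + f2\<^sup>2) a \<le> K * eval2 ?F a"
      using squares_le_basis_squares by blast
    \<comment> \<open>\<open>C * K\<close> bounds the negative part of \<open>g\<close> relative to
      \<open>?F\<close>; the added 1 keeps the denominator positive when
      \<open>C * K = 0\<close>.\<close>
    define c where "c = 1 / (C * K + 1)"
    have CK: "C * K + 1 > 0" using C K by (simp add: add_nonneg_pos)
    then have c: "c > 0" by (simp add: c_def)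
    have F: "eval2 ?F a \<ge> 0" for a by (simp add: sum_nonneg)
    have "psd (?F + smult [:c:] g)"
      unfolding psd_def
    proof
      fix a
      have "- eval2 g a \<le> C * (K * eval2 ?F a)"
        using C(2)[of a] mult_left_mono[OF K(2)[of a] C(1)] by linarith
      also have "\<dots> \<le> (C * K + 1) * eval2 ?F a" using F[of a] by (simp add: distrib_right mult.assoc del: eval2_sum)
      finally have "c * (- eval2 g a) \<le> c * ((C * K + 1) * eval2 ?F a)"
        using c by (intro mult_left_mono) auto
      also have "\<dots> = eval2 ?F a" using CK by (simp add: c_def del: eval2_sum)
      finally show "eval2 (?F + smult [:c:] g) a \<ge> 0" by simp
    qed
    moreover have "\<not> sos (?F + smult [:c:] g)"
    proof
      assume "sos (?F + smult [:c:] g)"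
      then obtain n :: nat and q where q: "?F + smult [:c:] g = (\<Sum>i<n. (q i)\<^sup>2)"
        by (auto simp: sos_def)
      have "total_degree (\<Sum>i<n. (q i)\<^sup>2) \<le> 2 * 3"
        unfolding q[symmetric] using total_degree_basis_squares g(1)
        by (intro total_degree_add_le total_degree_smult_le) simp_all
      then have deg: "total_degree (q i) \<le> 3" if "i < n" for i
        using sos_total_degree_le that by blast
      \<comment> \<open>Both \<open>?F\<close> and \<open>g\<close> vanish at \<open>p\<close>, so a
        sum of real squares is zero there.\<close>
      have "eval2 (q i) p = 0" if "i < n" "p \<in> Z - {w}" for i p
      proof -
        have "(\<Sum>i<n. (eval2 (q i) p)\<^sup>2) = eval2 (?F + smult [:c:] g) p" by (simp add: q)
        also have "\<dots> = 0"
          using g(2)[OF that(2)] eval2_basis_squares_Z[of p] that(2) by (simp del: eval2_sum)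
        finally show ?thesis using that(1) by (simp add: sum_nonneg_eq_0_iff)
      qed
      then have "q i \<in> I1 3 (Z - {w})" if "i < n" for i
        using deg that by (simp add: I1_def)
      then have "eval2 (q i) w = 0" if "i < n" for i
        using eval2_I1[OF _ w w] that by blast
      \<comment> \<open>All \<open>q i\<close> vanish at \<open>w\<close>, whereas
        \<open>?F + c g\<close> takes the positive value \<open>c g(w)\<close> there.\<close>
      then have "eval2 (?F + smult [:c:] g) w = 0" unfolding q by simp
      then show False using eval2_basis_squares_Z[OF w] c g(3) by (simp del: eval2_sum)
    qed
    ultimately show ?thesis using c by blast
  qed
  ultimately show ?thesis using g(3) by blast
qed

end

end

theorem theorem4p1:
  fixes f1 f2 :: poly2 and A :: "(real \<times> real) set"
  assumes "total_degree f1 = 3" and "total_degree f2 = 3"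
    and "coprime f1 f2"
    and "card {a. eval2 f1 a = 0 \<and> eval2 f2 a = 0} = 9"
    and "A \<subseteq> {a. eval2 f1 a = 0 \<and> eval2 f2 a = 0}" and "card A = 8"
  shows "hilberts_method_applies 3 A"
proof -
  define Z where "Z = {a. eval2 f1 a = 0 \<and> eval2 f2 a = 0}"
  interpret nine_points f1 f2 Z
    using assms by unfold_locales (simp_all add: Z_def)
  have A: "A \<subseteq> Z" using assms(5) by (simp add: Z_def)
  then have "card (Z - A) = 1"
    using assms(6) card_Z finite_subset[OF A finite_Z] by (simp add: card_Diff_subset)
  then obtain w where "Z - A = {w}" by (rule card_1_singletonE)
  then have w: "w \<in> Z" and A_eq: "A = Z - {w}" using A by auto
  show ?thesis
    unfolding hilberts_method_applies_def A_eq tilde_eq[OF w]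
    using full[OF w] no_zero_at_infinity[OF w] hilbert_perturbation[OF w] by simp
qed

end
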